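(* The ideal $\mathrm{nwd}$ of nowhere dense subsets of $\mathbb Q$ is a Grothendieck ideal; that is, the Banach space $c_{0,\mathrm{nwd}}$ is a Grothendieck space.
   Context: $\mathrm{nwd}=\{A\subseteq\mathbb Q: A\text{ is nowhere dense in }\mathbb Q\}$ ($\mathbb Q$ with its usual topology). For an ideal $\mathcal I$ of subsets of a countable set $D$, $c_{0,\mathcal I}=\{x\in\ell_\infty(D):\ \forall\epsilon>0\ \{d\in D:|x_d|\ge\epsilon\}\in\mathcal I\}$ with the supremum norm. A Banach space $X$ is Grothendieck if every weak$^*$ null sequence in $X^*$ is weakly null. An ideal $\mathcal I$ is called Grothendieck if $c_{0,\mathcal I}$ is Grothendieck. *)

theory Defs
  imports "HOL-Analysis.Analysis" "HOL-Probability.Discrete_Topology"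
begin

section \<open>Grothendieck spaces\<close>

text \<open>
  A Banach space is given as a complete linear subspace \<open>X\<close> of a real normed vector space.
  Spaces \<open>c0 I\<close> depend on an ideal \<open>I\<close> and hence cannot be types, which is why the dual and the
  bidual are sets of functions here rather than types of bounded linear functions.
\<close>

definition banach_subspace :: "'a::real_normed_vector set \<Rightarrow> bool" where
  "banach_subspace X \<longleftrightarrow> subspace X \<and> complete X"

text \<open>
  Functionals on \<open>X\<close> are represented by functions that vanish outside \<open>X\<close>. This makes the
  representation unique and is preserved by the pointwise vector space operations.
\<close>

definition dual_space :: "'a::real_normed_vector set \<Rightarrow> ('a \<Rightarrow> real) set" where
  "dual_space X = {f.
     (\<forall>x\<in>X. \<forall>y\<in>X. f (x + y) = f x + f y) \<and>
     (\<forall>c. \<forall>x\<in>X. f (c *\<^sub>R x) = c * f x) \<and>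
     (\<exists>K. \<forall>x\<in>X. \<bar>f x\<bar> \<le> K * norm x) \<and>
     (\<forall>x. x \<notin> X \<longrightarrow> f x = 0)}"

definition dual_norm :: "'a::real_normed_vector set \<Rightarrow> ('a \<Rightarrow> real) \<Rightarrow> real" where
  "dual_norm X f = (SUP x\<in>{x \<in> X. norm x \<le> 1}. \<bar>f x\<bar>)"

definition bidual_space :: "'a::real_normed_vector set \<Rightarrow> (('a \<Rightarrow> real) \<Rightarrow> real) set" where
  "bidual_space X = {\<phi>.
     (\<forall>f\<in>dual_space X. \<forall>g\<in>dual_space X. \<phi> (\<lambda>x. f x + g x) = \<phi> f + \<phi> g) \<and>
     (\<forall>c. \<forall>f\<in>dual_space X. \<phi> (\<lambda>x. c * f x) = c * \<phi> f) \<and>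
     (\<exists>K. \<forall>f\<in>dual_space X. \<bar>\<phi> f\<bar> \<le> K * dual_norm X f) \<and>
     (\<forall>f. f \<notin> dual_space X \<longrightarrow> \<phi> f = 0)}"

definition weak_star_null :: "'a::real_normed_vector set \<Rightarrow> (nat \<Rightarrow> 'a \<Rightarrow> real) \<Rightarrow> bool" where
  "weak_star_null X F \<longleftrightarrow> (\<forall>x\<in>X. (\<lambda>n. F n x) \<longlonglongrightarrow> 0)"

definition weakly_null_in_dual :: "'a::real_normed_vector set \<Rightarrow> (nat \<Rightarrow> 'a \<Rightarrow> real) \<Rightarrow> bool" where
  "weakly_null_in_dual X F \<longleftrightarrow> (\<forall>\<phi>\<in>bidual_space X. (\<lambda>n. \<phi> (F n)) \<longlonglongrightarrow> 0)"

definition grothendieck_space :: "'a::real_normed_vector set \<Rightarrow> bool" where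
  "grothendieck_space X \<longleftrightarrow> banach_subspace X \<and>
     (\<forall>F. (\<forall>n. F n \<in> dual_space X) \<and> weak_star_null X F \<longrightarrow> weakly_null_in_dual X F)"

section \<open>Grothendieck ideals\<close>

definition set_ideal :: "'d set set \<Rightarrow> bool" where
  "set_ideal I \<longleftrightarrow> {} \<in> I \<and> (\<forall>A\<in>I. \<forall>B. B \<subseteq> A \<longrightarrow> B \<in> I) \<and> (\<forall>A\<in>I. \<forall>B\<in>I. A \<union> B \<in> I)"

text \<open>
  \<open>'d discrete \<Rightarrow>\<^sub>C real\<close> is the space of all bounded real functions on \<open>'d\<close> with
  the supremum norm, since every function on a discrete space is continuous.
\<close>

type_synonym 'd l_infty = "'d discrete \<Rightarrow>\<^sub>C real"

definition c0 :: "'d set set \<Rightarrow> 'd l_infty set" where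
  "c0 I = {x. \<forall>\<epsilon>>0. {d. \<bar>apply_bcontfun x (discrete d)\<bar> \<ge> \<epsilon>} \<in> I}"

definition grothendieck_ideal :: "'d::countable set set \<Rightarrow> bool" where
  "grothendieck_ideal I \<longleftrightarrow> set_ideal I \<and> grothendieck_space (c0 I)"

section \<open>Nowhere dense sets of rationals\<close>

text \<open>The type of rationals has no topology in the library; it is pulled back from the reals.\<close>

definition rat_topology :: "rat topology" where
  "rat_topology = pullback_topology UNIV (of_rat :: rat \<Rightarrow> real) euclidean"

definition nwd :: "rat set set" where
  "nwd = {A. rat_topology interior_of (rat_topology closure_of A) = {}}"

end

theory Submission
  imports Defs "HOL-Library.Diagonal_Subsequence"
begin

text \<open>
  A functional on \<open>c0 I\<close> is a bounded finitely additive signed measure, and its variation is a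
  finitely additive positive content on all subsets of the index set. Let \<open>F\<close>
  be a weak* null sequence; by completeness it is norm bounded (\<open>weak_star_null_bounded\<close>), so its
  variations have uniformly bounded mass. The proof has two halves.

  The first half is special to nowhere dense sets and says that the variations are uniformly
  exhaustive: they cannot keep a fixed mass \<open>\<epsilon>\<close> on the members of a disjoint sequence \<open>A k\<close> in
  \<open>nwd\<close>. The union of the \<open>A k\<close> may well be dense. However, every basic interval splits into as
  many disjoint subintervals as desired, so one of them is light for infinitely many of the measures.
  Deleting a light subinterval of every basic interval, along a diagonal subsequence, costs at most
  \<open>\<epsilon>/4\<close> of the mass and makes the union of what remains nowhere dense (\<open>nwd_thinning\<close>).
  On that union \<open>B\<close> every bounded function belongs to \<open>c0 nwd\<close>, that is, one is inside
  \<open>\<ell>\<^sub>\<infinity>(B)\<close>, and there a gliding hump in the style of Phillips shows that a weak* null sequence cannot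
  keep mass on disjoint sets (\<open>phillips_disjoint\<close>).

  The second half holds for every ideal: uniform exhaustivity turns weak* null into weakly null.
  Suppose that a bidual element \<open>\<phi>\<close> satisfies \<open>\<delta> \<le> \<phi> (F n)\<close> for all \<open>n\<close>. Helly's
  theorem, in the form of \<open>convex_finite_alternative\<close>, replaces \<open>\<phi>\<close> by points \<open>x N\<close> of the unit
  ball of \<open>c0 I\<close> with \<open>c \<le> F n (x N)\<close> for all \<open>n \<le> N\<close>. Put the quadratic form
  \<open>energy x = \<Sum>n. |F n|(x\<^sup>2) / 2\<^sup>n\<close> on \<open>c0 I\<close>. As in a Hilbert space, points that almost minimise
  the energy on the convex hulls of the tails of \<open>x\<close> are close to each other. Since the variations are
  uniformly exhaustive, they are uniformly absolutely continuous with respect to the control measure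
  \<open>\<Sum>n. |F n| / 2\<^sup>n\<close>, so that elements of small energy are small under all \<open>F n\<close> at once
  (\<open>energy_controls\<close>). Hence there are \<open>y\<close> and, arbitrarily far out, \<open>y'\<close> at which all \<open>F n\<close>
  nearly agree. But \<open>F n y\<close> tends to \<open>0\<close>, while \<open>F n y'\<close> is at least \<open>c\<close> once \<open>y'\<close> lies
  in the hull of a tail that starts beyond \<open>n\<close>.
\<close>

section \<open>Finitely additive contents\<close>

text \<open>
  The variations of functionals enter only through this notion: all subsets are measured, and
  countable additivity is absent.
\<close>

definition bounded_content :: "('a set \<Rightarrow> real) \<Rightarrow> real \<Rightarrow> bool" where
  "bounded_content \<mu> C \<longleftrightarrow>
     (\<forall>A B. A \<inter> B = {} \<longrightarrow> \<mu> (A \<union> B) = \<mu> A + \<mu> B) \<and> (\<forall>A. 0 \<le> \<mu> A \<and> \<mu> A \<le> C)"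

lemma content_disjoint_Un:
  "bounded_content \<mu> C \<Longrightarrow> A \<inter> B = {} \<Longrightarrow> \<mu> (A \<union> B) = \<mu> A + \<mu> B"
  by (auto simp: bounded_content_def)

lemma content_nonneg: "bounded_content \<mu> C \<Longrightarrow> 0 \<le> \<mu> A"
  and content_le: "bounded_content \<mu> C \<Longrightarrow> \<mu> A \<le> C"
  by (auto simp: bounded_content_def)

lemma content_empty: "bounded_content \<mu> C \<Longrightarrow> \<mu> {} = 0"
  using content_disjoint_Un[of \<mu> C "{}" "{}"] by simp

lemma content_split: "bounded_content \<mu> C \<Longrightarrow> \<mu> A = \<mu> (A \<inter> B) + \<mu> (A - B)"
  using content_disjoint_Un[of \<mu> C "A \<inter> B" "A - B"] by (simp add: Int_Diff_disjoint Int_Diff_Un)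

lemma content_mono: "bounded_content \<mu> C \<Longrightarrow> A \<subseteq> B \<Longrightarrow> \<mu> A \<le> \<mu> B"
  using content_split[of \<mu> C B A] content_nonneg[of \<mu> C "B - A"] by (simp add: Int_absorb1)

lemma content_subadditive: "bounded_content \<mu> C \<Longrightarrow> \<mu> (A \<union> B) \<le> \<mu> A + \<mu> B"
  using content_disjoint_Un[of \<mu> C A "B - A"] content_mono[of \<mu> C "B - A" B] by auto

lemma content_UN_le:
  assumes "bounded_content \<mu> C" "finite J"
  shows "\<mu> (\<Union>j\<in>J. S j) \<le> (\<Sum>j\<in>J. \<mu> (S j))"
  using assms(2)
proof induction
  case (insert x J)
  then show ?case using content_subadditive[OF assms(1), of "S x" "\<Union>j\<in>J. S j"] by simp
qed (simp add: content_empty[OF assms(1)])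

lemma content_disjoint_UN:
  assumes "bounded_content \<mu> C" "finite J" "disjoint_family_on S J"
  shows "\<mu> (\<Union>j\<in>J. S j) = (\<Sum>j\<in>J. \<mu> (S j))"
  using assms(2,3)
proof (induction)
  case (insert x J)
  then have "S x \<inter> (\<Union>j\<in>J. S j) = {}" "disjoint_family_on S J"
    by (auto simp: disjoint_family_on_def)
  then show ?case using insert content_disjoint_Un[OF assms(1), of "S x" "\<Union>j\<in>J. S j"] by simp
qed (simp add: content_empty[OF assms(1)])

lemma content_pigeonhole:
  assumes "bounded_content \<mu> C" "disjoint_family_on S {..<p}" "0 < p"
  shows "\<exists>j<p. \<mu> (S j) \<le> C / real p"
proof (rule ccontr)
  assume "\<not> ?thesis"
  then have "\<And>j. j < p \<Longrightarrow> C / real p < \<mu> (S j)" by auto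
  then have "(\<Sum>j<p. C / real p) < (\<Sum>j<p. \<mu> (S j))"
    using assms(3) by (intro sum_strict_mono) auto
  moreover have "(\<Sum>j<p. \<mu> (S j)) \<le> C"
    using content_disjoint_UN[OF assms(1) _ assms(2)] content_le[OF assms(1)]
    by (metis finite_lessThan)
  ultimately show False using assms(3) by simp
qed

section \<open>Nowhere dense sets of rationals\<close>

lemma topspace_rat_topology [simp]: "topspace rat_topology = UNIV"
  by (simp add: rat_topology_def topspace_pullback_topology)

lemma openin_rat_interval: "openin rat_topology {a<..<b}"
  unfolding rat_topology_def openin_pullback_topology
  by (rule exI[of _ "{real_of_rat a<..<real_of_rat b}"]) (auto simp: of_rat_less)

lemma openin_rat_contains_interval:
  assumes "openin rat_topology U" "x \<in> U"
  obtains a b where "a < x" "x < b" "{a<..<b} \<subseteq> U"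
proof -
  obtain T :: "real set" where T: "open T" "U = of_rat -` T"
    using assms(1) by (auto simp: rat_topology_def openin_pullback_topology)
  then obtain e where e: "e > 0" "ball (real_of_rat x) e \<subseteq> T"
    using assms(2) open_contains_ball by blast
  obtain a where a: "real_of_rat x - e < of_rat a" "of_rat a < real_of_rat x"
    using of_rat_dense[of "real_of_rat x - e" "real_of_rat x"] e by auto
  obtain b where b: "real_of_rat x < of_rat b" "of_rat b < real_of_rat x + e"
    using of_rat_dense[of "real_of_rat x" "real_of_rat x + e"] e by auto
  have "{a<..<b} \<subseteq> U"
  proof
    fix y assume "y \<in> {a<..<b}"
    then have "real_of_rat a < of_rat y" "real_of_rat y < of_rat b" by (auto simp: of_rat_less)
    then have "of_rat y \<in> ball (real_of_rat x) e" using a b by (auto simp: dist_real_def)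
    then show "y \<in> U" using e T by auto
  qed
  then show ?thesis using that a b by (auto simp: of_rat_less)
qed

text \<open>
  The order-theoretic form of nowhere density. It reduces everything below to rational intervals,
  and its witnesses can be found by refining one gap inside another.
\<close>

lemma nwd_iff_gap:
  "A \<in> nwd \<longleftrightarrow> (\<forall>a b. a < b \<longrightarrow> (\<exists>c d. a \<le> c \<and> c < d \<and> d \<le> b \<and> A \<inter> {c<..<d} = {}))"
    (is "_ \<longleftrightarrow> ?gaps")
proof
  assume A: "A \<in> nwd"
  show ?gaps
  proof (intro allI impI)
    fix a b :: rat assume "a < b"
    then obtain m where "a < m" "m < b" using dense by blast
    then have "\<not> {a<..<b} \<subseteq> rat_topology closure_of A"
      using A interior_of_maximal[OF _ openin_rat_interval, of a b "rat_topology closure_of A"]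
      by (auto simp: nwd_def)
    then obtain x where x: "a < x" "x < b" "x \<notin> rat_topology closure_of A"
      by (meson greaterThanLessThan_iff subsetI)
    then obtain U where U: "openin rat_topology U" "x \<in> U" "A \<inter> U = {}"
      by (auto simp: in_closure_of)
    then obtain p q where pq: "p < x" "x < q" "{p<..<q} \<subseteq> U"
      using openin_rat_contains_interval by metis
    show "\<exists>c d. a \<le> c \<and> c < d \<and> d \<le> b \<and> A \<inter> {c<..<d} = {}"
      using x pq U by (intro exI[of _ "max a p"] exI[of _ "min b q"]) fastforce
  qed
next
  assume gaps: ?gaps
  have False if x: "x \<in> rat_topology interior_of (rat_topology closure_of A)" for x
  proof -
    let ?U = "rat_topology interior_of (rat_topology closure_of A)"
    obtain a b where ab: "a < x" "x < b" "{a<..<b} \<subseteq> ?U"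
      using openin_rat_contains_interval[OF openin_interior_of x] by metis
    then obtain c d where cd: "a \<le> c" "c < d" "d \<le> b" "A \<inter> {c<..<d} = {}"
      using gaps by (meson less_trans)
    obtain m where m: "c < m" "m < d" using dense cd by blast
    then have "m \<in> {a<..<b}" using cd by simp
    then have "m \<in> rat_topology closure_of A"
      using ab(3) interior_of_subset[of rat_topology "rat_topology closure_of A"] by blast
    then show False
      using m cd openin_rat_interval[of c d] unfolding in_closure_of by (metis disjoint_iff greaterThanLessThan_iff)
  qed
  then show "A \<in> nwd" by (auto simp: nwd_def)
qed

lemma set_ideal_finite_UN:
  assumes "set_ideal I" "finite J" "\<And>j. j \<in> J \<Longrightarrow> A j \<in> I"
  shows "(\<Union>j\<in>J. A j) \<in> I"
  using assms(2,3) by induction (use assms(1) in \<open>auto simp: set_ideal_def\<close>)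

lemma nwd_subset: "A \<in> nwd \<Longrightarrow> B \<subseteq> A \<Longrightarrow> B \<in> nwd"
  unfolding nwd_iff_gap
proof (intro allI impI)
  fix a b :: rat
  assume A: "\<forall>a b. a < b \<longrightarrow> (\<exists>c d. a \<le> c \<and> c < d \<and> d \<le> b \<and> A \<inter> {c<..<d} = {})"
    and "B \<subseteq> A" "a < b"
  then obtain c d where "a \<le> c" "c < d" "d \<le> b" "A \<inter> {c<..<d} = {}" by blast
  then show "\<exists>c d. a \<le> c \<and> c < d \<and> d \<le> b \<and> B \<inter> {c<..<d} = {}"
    using \<open>B \<subseteq> A\<close> by (intro exI[of _ c] exI[of _ d]) auto
qed

lemma nwd_Un:
  assumes "A \<in> nwd" "B \<in> nwd"
  shows "A \<union> B \<in> nwd"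
  unfolding nwd_iff_gap
proof (intro allI impI)
  fix a b :: rat assume "a < b"
  then obtain c d where cd: "a \<le> c" "c < d" "d \<le> b" "A \<inter> {c<..<d} = {}"
    using assms(1) unfolding nwd_iff_gap by blast
  then obtain p q where pq: "c \<le> p" "p < q" "q \<le> d" "B \<inter> {p<..<q} = {}"
    using assms(2) unfolding nwd_iff_gap by blast
  have "{p<..<q} \<subseteq> {c<..<d}" using pq by auto
  then show "\<exists>c d. a \<le> c \<and> c < d \<and> d \<le> b \<and> (A \<union> B) \<inter> {c<..<d} = {}"
    using cd pq by (intro exI[of _ p] exI[of _ q]) auto
qed

lemma set_ideal_nwd: "set_ideal nwd"
proof -
  have "{} \<in> nwd" unfolding nwd_iff_gap by blast
  then show ?thesis unfolding set_ideal_def using nwd_subset nwd_Un by blast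
qed

text \<open>
  Let \<open>(a, b)\<close> run through all rational intervals. Cut \<open>(a, b)\<close> into \<open>p\<close> subintervals; under each
  \<open>\<mu> n\<close> one of them has mass at most \<open>C / p\<close>, and by the pigeonhole principle the same one serves
  infinitely many \<open>n\<close>. A diagonal subsequence \<open>r\<close> makes the \<open>i\<close>-th chosen subinterval \<open>V i\<close> light for
  all \<open>\<mu> (r k)\<close> with \<open>i < k\<close>, and \<open>W k\<close> is the union of these finitely many \<open>V i\<close>. The interval
  \<open>V i\<close> then meets only \<open>A 0 - W 0, ..., A i - W i\<close>, whose union is nowhere dense
  and leaves a gap inside \<open>V i\<close>.
\<close>

lemma nwd_thinning:
  fixes \<mu> :: "nat \<Rightarrow> rat set \<Rightarrow> real"
  assumes content: "\<And>n. bounded_content (\<mu> n) C" and "0 < \<epsilon>"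
  shows "\<exists>r W. strict_mono (r :: nat \<Rightarrow> nat) \<and> (\<forall>k. \<mu> (r k) (W k) \<le> \<epsilon>) \<and>
    (\<forall>A. (\<forall>k. A k \<in> nwd) \<longrightarrow> (\<Union>k. A k - W k) \<in> nwd)"
proof -
  define U where "U i = (from_nat i :: rat \<times> rat)" for i
  define gap where "gap i V \<longleftrightarrow>
      (fst (U i) < snd (U i) \<longrightarrow> (\<exists>c d. fst (U i) \<le> c \<and> c < d \<and> d \<le> snd (U i) \<and> V = {c<..<d}))"
    for i V
  \<comment> \<open>The \<open>i\<close>-th interval has a subinterval of mass at most \<open>\<epsilon> / 2 ^ (i + 1)\<close> along the subsequence \<open>s\<close>.\<close>
  define light where "light i s \<longleftrightarrow> (\<exists>V. gap i V \<and> (\<forall>k. \<mu> (s k) V \<le> \<epsilon> * (1/2) ^ Suc i))"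
    for i and s :: "nat \<Rightarrow> nat"
  interpret subseqs light
  proof
    fix i :: nat and s :: "nat \<Rightarrow> nat"
    obtain a b where ab: "U i = (a, b)" by fastforce
    show "\<exists>r'. strict_mono r' \<and> light i (s \<circ> r')"
    proof (cases "a < b")
      case False
      have "light i s"
        unfolding light_def gap_def
        by (rule exI[of _ "{}"]) (use False ab \<open>0 < \<epsilon>\<close> content_empty[OF content] in auto)
      then show ?thesis by (intro exI[of _ id]) (auto simp: strict_mono_def)
    next
      case True
      obtain p :: nat where p: "C / (\<epsilon> * (1/2) ^ Suc i) < real p" "0 < p"
        using reals_Archimedean2[of "max 0 (C / (\<epsilon> * (1/2) ^ Suc i))"] by auto
      define S where "S j = {a + (b - a) * of_nat j / of_nat p <..< a + (b - a) * of_nat (Suc j) / of_nat p}" for j :: nat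
      have S_order: "a + (b - a) * of_nat (Suc j) / of_nat p \<le> a + (b - a) * of_nat k / of_nat p"
        if "j < k" for j k :: nat
      proof -
        have "(of_nat (Suc j) :: rat) \<le> of_nat k" using that by (simp only: of_nat_le_iff Suc_leI)
        then have "(b - a) * of_nat (Suc j) \<le> (b - a) * of_nat k"
          using True by (intro mult_left_mono) simp_all
        then have "(b - a) * of_nat (Suc j) / of_nat p \<le> (b - a) * of_nat k / of_nat p"
          by (rule divide_right_mono) simp
        then show ?thesis by (rule add_left_mono)
      qed
      have "S j \<inter> S k = {}" if "j < k" for j k
        using S_order[OF that] unfolding S_def by force
      then have disj: "disjoint_family_on S {..<p}"
        unfolding disjoint_family_on_def by (metis inf_commute linorder_neqE_nat)
      have "\<forall>k. \<exists>j<p. \<mu> (s k) (S j) \<le> C / real p"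
        using content_pigeonhole[OF content disj p(2)] by auto
      then obtain j where j: "\<And>k. j k < p" "\<And>k. \<mu> (s k) (S (j k)) \<le> C / real p" by metis
      have "range j \<subseteq> {..<p}" using j(1) by (simp add: image_subset_iff)
      then have "finite (range j)" by (rule finite_subset) simp
      then obtain k0 where "infinite {k. j k = j k0}"
        using pigeonhole_infinite[of UNIV j] by auto
      from infinite_enumerate[OF this] obtain r' :: "nat \<Rightarrow> nat"
        where r': "strict_mono r'" "\<And>k. j (r' k) = j k0" by auto
      have Cp: "C / real p \<le> \<epsilon> * (1/2) ^ Suc i"
        using p \<open>0 < \<epsilon>\<close> by (simp add: field_simps)
      have "gap i (S (j k0))"
        unfolding gap_def
      proof (intro impI exI conjI)
        show "S (j k0) = {a + (b - a) * of_nat (j k0) / of_nat p <..< a + (b - a) * of_nat (Suc (j k0)) / of_nat p}"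
          by (simp add: S_def)
        have "(of_nat (Suc (j k0)) :: rat) \<le> of_nat p" using j(1)[of k0] by (simp only: of_nat_le_iff Suc_leI)
        then have "(b - a) * of_nat (Suc (j k0)) / of_nat p \<le> b - a"
          using True p by (simp add: divide_le_eq mult_left_mono)
        then show "a + (b - a) * of_nat (Suc (j k0)) / of_nat p \<le> snd (U i)" by (simp add: ab)
        show "a + (b - a) * of_nat (j k0) / of_nat p < a + (b - a) * of_nat (Suc (j k0)) / of_nat p"
          using True p by (simp add: divide_strict_right_mono)
        show "fst (U i) \<le> a + (b - a) * of_nat (j k0) / of_nat p" using True p by (simp add: ab)
      qed
      moreover have "\<mu> ((s \<circ> r') k) (S (j k0)) \<le> \<epsilon> * (1/2) ^ Suc i" for k
        using order_trans[OF j(2)[of "r' k"] Cp] unfolding r'(2) comp_def .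
      ultimately have "light i (s \<circ> r')" unfolding light_def by blast
      then show ?thesis using r'(1) by blast
    qed
  qed
  have "light i (diagseq \<circ> (+) (Suc i))" for i
    by (rule diagseq_holds) (auto simp: light_def)
  then have "\<forall>i. \<exists>V. gap i V \<and> (\<forall>k. \<mu> (diagseq (Suc i + k)) V \<le> \<epsilon> * (1/2) ^ Suc i)"
    unfolding light_def comp_def by (rule allI)
  from choice[OF this] obtain V
    where V: "\<And>i. gap i (V i)" "\<And>i k. \<mu> (diagseq (Suc i + k)) (V i) \<le> \<epsilon> * (1/2) ^ Suc i"
    by blast
  show ?thesis
  proof (intro exI[of _ diagseq] exI[of _ "\<lambda>k. \<Union>i<k. V i"] conjI allI impI)
    show "strict_mono diagseq" by (rule subseq_diagseq)
    show "\<mu> (diagseq k) (\<Union>i<k. V i) \<le> \<epsilon>" for k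
    proof -
      have "\<mu> (diagseq k) (\<Union>i<k. V i) \<le> (\<Sum>i<k. \<mu> (diagseq k) (V i))"
        by (rule content_UN_le[OF content]) simp
      also have "\<dots> \<le> (\<Sum>i<k. \<epsilon> * (1/2) ^ Suc i)"
      proof (rule sum_mono)
        fix i assume "i \<in> {..<k}"
        then have "Suc i + (k - Suc i) = k" by simp
        then show "\<mu> (diagseq k) (V i) \<le> \<epsilon> * (1/2) ^ Suc i" using V(2)[of i "k - Suc i"] by metis
      qed
      also have "\<dots> = \<epsilon> * (1 - (1/2) ^ k)"
        by (induction k) (simp_all add: algebra_simps)
      also have "\<dots> \<le> \<epsilon>" using \<open>0 < \<epsilon>\<close> by simp
      finally show ?thesis .
    qed
    fix A :: "nat \<Rightarrow> rat set" assume A: "\<forall>k. A k \<in> nwd"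
    show "(\<Union>k. A k - (\<Union>i<k. V i)) \<in> nwd"
      unfolding nwd_iff_gap
    proof (intro allI impI)
      fix a b :: rat assume "a < b"
      define i where "i = to_nat (a, b)"
      obtain c d where cd: "a \<le> c" "c < d" "d \<le> b" "V i = {c<..<d}"
        using V(1)[of i] \<open>a < b\<close> by (auto simp: gap_def U_def i_def)
      have "(\<Union>k\<in>{..i}. A k) \<in> nwd" using A by (intro set_ideal_finite_UN[OF set_ideal_nwd]) auto
      then obtain c' d' where cd': "c \<le> c'" "c' < d'" "d' \<le> d" "(\<Union>k\<in>{..i}. A k) \<inter> {c'<..<d'} = {}"
        using cd(2) unfolding nwd_iff_gap by meson
      \<comment> \<open>From index \<open>i + 1\<close> on, \<open>V i\<close> has been removed; the sets before are avoided by the choice of the gap.\<close>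
      have "(\<Union>k. A k - (\<Union>i<k. V i)) \<inter> {c'<..<d'} = {}"
      proof (intro equals0I)
        fix x assume x: "x \<in> (\<Union>k. A k - (\<Union>i<k. V i)) \<inter> {c'<..<d'}"
        then obtain k where k: "x \<in> A k" "x \<notin> (\<Union>i<k. V i)" by auto
        have "x \<in> V i" using x cd cd' by auto
        then have "k \<le> i" using k by (meson UN_I lessThan_iff not_le)
        then show False using k x cd' by auto
      qed
      then show "\<exists>c d. a \<le> c \<and> c < d \<and> d \<le> b \<and> (\<Union>k. A k - (\<Union>i<k. V i)) \<inter> {c<..<d} = {}"
        using cd cd' by (intro exI[of _ c'] exI[of _ d']) auto
    qed
  qed
qed

section \<open>Bounded functions and the space c0 of an ideal\<close>

text \<open>
  The index type of \<open>l_infty\<close> is a discrete copy of \<open>'d\<close>; \<open>val\<close> and \<open>bfun\<close> translate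
  between its elements and plain functions on \<open>'d\<close>.
\<close>

definition val :: "'d l_infty \<Rightarrow> 'd \<Rightarrow> real" where
  "val x d = apply_bcontfun x (discrete d)"

definition bfun :: "('d \<Rightarrow> real) \<Rightarrow> 'd l_infty" where
  "bfun g = Bcontfun (\<lambda>t. g (of_discrete t))"

lemma val_bfun:
  assumes "\<And>d. \<bar>g d\<bar> \<le> K"
  shows "val (bfun g) d = g d"
proof -
  have "continuous_on UNIV (\<lambda>t::'a discrete. g (of_discrete t))"
    by (simp add: continuous_on_open_invariant open_discrete)
  then have "(\<lambda>t. g (of_discrete t)) \<in> bcontfun"
    using assms by (intro bcontfun_normI[where b = K]) auto
  then show ?thesis
    by (simp add: val_def bfun_def Bcontfun_inverse discrete_inverse)
qed

lemma val_eqI: "(\<And>d. val x d = val y d) \<Longrightarrow> x = y"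
  unfolding val_def by (rule bcontfun_eqI) (metis of_discrete_inverse)

lemma val_add [simp]: "val (x + y) d = val x d + val y d"
  and val_diff [simp]: "val (x - y) d = val x d - val y d"
  and val_minus [simp]: "val (- x) d = - val x d"
  and val_scaleR [simp]: "val (c *\<^sub>R x) d = c * val x d"
  and val_zero [simp]: "val 0 d = 0"
  by (simp_all add: val_def)

lemma abs_val_le_norm: "\<bar>val x d\<bar> \<le> norm x"
  using norm_bounded[of x "discrete d"] by (simp add: val_def)

lemma norm_leI: "(\<And>d. \<bar>val x d\<bar> \<le> b) \<Longrightarrow> norm x \<le> b"
  unfolding val_def by (rule norm_bound) (metis of_discrete_inverse real_norm_def)

lemma c0_iff: "x \<in> c0 I \<longleftrightarrow> (\<forall>\<epsilon>>0. {d. \<epsilon> \<le> \<bar>val x d\<bar>} \<in> I)"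
  by (simp add: c0_def val_def)

lemma c0_large: "x \<in> c0 I \<Longrightarrow> 0 < \<epsilon> \<Longrightarrow> {d. \<epsilon> \<le> \<bar>val x d\<bar>} \<in> I"
  by (simp add: c0_iff)

definition cut :: "'d set \<Rightarrow> 'd l_infty \<Rightarrow> 'd l_infty" where
  "cut A x = bfun (\<lambda>d. indicator A d * val x d)"

lemma val_cut [simp]: "val (cut A x) d = indicator A d * val x d"
  unfolding cut_def
  by (rule val_bfun[where K = "norm x"]) (auto simp: indicator_def abs_val_le_norm)

locale c0_ideal =
  fixes I :: "'d set set"
  assumes ideal: "set_ideal I"
begin

lemma ideal_subset: "A \<in> I \<Longrightarrow> B \<subseteq> A \<Longrightarrow> B \<in> I"
  and ideal_Un: "A \<in> I \<Longrightarrow> B \<in> I \<Longrightarrow> A \<union> B \<in> I"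
  and ideal_empty: "{} \<in> I"
  using ideal by (auto simp: set_ideal_def)

lemma c0_solid:
  assumes "x \<in> c0 I" "\<And>d. \<bar>val y d\<bar> \<le> \<bar>val x d\<bar>"
  shows "y \<in> c0 I"
  unfolding c0_iff
proof (intro allI impI)
  fix \<epsilon> :: real assume "\<epsilon> > 0"
  then have "{d. \<epsilon> \<le> \<bar>val x d\<bar>} \<in> I" using assms(1) by (simp add: c0_iff)
  moreover have "{d. \<epsilon> \<le> \<bar>val y d\<bar>} \<subseteq> {d. \<epsilon> \<le> \<bar>val x d\<bar>}"
    using assms(2) order_trans by blast
  ultimately show "{d. \<epsilon> \<le> \<bar>val y d\<bar>} \<in> I" by (rule ideal_subset)
qed

lemma c0_supported:
  assumes "A \<in> I" "\<And>d. d \<notin> A \<Longrightarrow> val x d = 0"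
  shows "x \<in> c0 I"
  unfolding c0_iff
proof (intro allI impI ideal_subset[OF assms(1)] subsetI)
  fix \<epsilon> :: real and d assume "0 < \<epsilon>" "d \<in> {d. \<epsilon> \<le> \<bar>val x d\<bar>}"
  then show "d \<in> A" using assms(2)[of d] by (cases "d \<in> A") auto
qed

lemma c0_zero: "0 \<in> c0 I"
  by (rule c0_supported[OF ideal_empty]) simp

lemma c0_scaleR:
  assumes "x \<in> c0 I"
  shows "c *\<^sub>R x \<in> c0 I"
proof (cases "c = 0")
  case False
  show ?thesis unfolding c0_iff
  proof (intro allI impI)
    fix \<epsilon> :: real assume "\<epsilon> > 0"
    then have "{d. \<epsilon> / \<bar>c\<bar> \<le> \<bar>val x d\<bar>} \<in> I" using False assms by (simp add: c0_iff)
    then show "{d. \<epsilon> \<le> \<bar>val (c *\<^sub>R x) d\<bar>} \<in> I"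
      using False by (simp add: divide_le_eq abs_mult mult.commute)
  qed
qed (simp add: c0_zero)

lemma c0_add:
  assumes "x \<in> c0 I" "y \<in> c0 I"
  shows "x + y \<in> c0 I"
  unfolding c0_iff
proof (intro allI impI)
  fix \<epsilon> :: real assume "\<epsilon> > 0"
  then have "{d. \<epsilon> / 2 \<le> \<bar>val x d\<bar>} \<union> {d. \<epsilon> / 2 \<le> \<bar>val y d\<bar>} \<in> I"
    using assms by (intro ideal_Un c0_large) simp_all
  then show "{d. \<epsilon> \<le> \<bar>val (x + y) d\<bar>} \<in> I" by (rule ideal_subset) auto
qed

lemma c0_diff: "x \<in> c0 I \<Longrightarrow> y \<in> c0 I \<Longrightarrow> x - y \<in> c0 I"
  using c0_add[of x "(-1) *\<^sub>R y"] c0_scaleR[of y "-1"] by simp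

lemma c0_cut: "x \<in> c0 I \<Longrightarrow> cut A x \<in> c0 I"
  by (erule c0_solid) (simp add: indicator_def)

lemma subspace_c0: "subspace (c0 I)"
  by (simp add: subspace_def c0_zero c0_add c0_scaleR)

lemma closed_c0: "closed (c0 I)"
  unfolding closed_sequential_limits
proof (intro allI impI)
  fix x :: "nat \<Rightarrow> 'd l_infty" and l
  assume x: "(\<forall>n. x n \<in> c0 I) \<and> x \<longlonglongrightarrow> l"
  show "l \<in> c0 I" unfolding c0_iff
  proof (intro allI impI)
    fix \<epsilon> :: real assume "\<epsilon> > 0"
    then obtain n where n: "norm (x n - l) < \<epsilon> / 2"
      using x LIMSEQ_D[of x l "\<epsilon> / 2"] by auto
    have "{d. \<epsilon> / 2 \<le> \<bar>val (x n) d\<bar>} \<in> I" using x \<open>\<epsilon> > 0\<close> by (intro c0_large) simp_all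
    moreover have "\<epsilon> / 2 \<le> \<bar>val (x n) d\<bar>" if "\<epsilon> \<le> \<bar>val l d\<bar>" for d
      using abs_val_le_norm[of "x n - l" d] that n by simp
    ultimately show "{d. \<epsilon> \<le> \<bar>val l d\<bar>} \<in> I" by (auto elim: ideal_subset)
  qed
qed

lemma banach_subspace_c0: "banach_subspace (c0 I)"
  by (simp add: banach_subspace_def subspace_c0 complete_eq_closed closed_c0)

section \<open>Variation of a functional\<close>

text \<open>
  For \<open>F\<close> in the dual and a bounded \<open>g \<ge> 0\<close> this is \<open>|F|(g)\<close>, where \<open>|F|\<close> is the modulus of \<open>F\<close> in
  the Banach lattice sense. Allowing all bounded \<open>g\<close>, and not only members of \<open>c0 I\<close>, gives
  the variation of \<open>F\<close> on a set as the value at its indicator and the norm of \<open>F\<close> as the value at \<open>1\<close>.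
\<close>

definition tv :: "('d l_infty \<Rightarrow> real) \<Rightarrow> ('d \<Rightarrow> real) \<Rightarrow> real" where
  "tv F g = (SUP y\<in>{y \<in> c0 I. \<forall>d. \<bar>val y d\<bar> \<le> g d}. F y)"

abbreviation dual :: "('d l_infty \<Rightarrow> real) set" where
  "dual \<equiv> dual_space (c0 I)"

lemma dual_add: "F \<in> dual \<Longrightarrow> x \<in> c0 I \<Longrightarrow> y \<in> c0 I \<Longrightarrow> F (x + y) = F x + F y"
  and dual_scaleR: "F \<in> dual \<Longrightarrow> x \<in> c0 I \<Longrightarrow> F (c *\<^sub>R x) = c * F x"
  by (auto simp: dual_space_def)

lemma dual_minus: "F \<in> dual \<Longrightarrow> x \<in> c0 I \<Longrightarrow> F (- x) = - F x"
  using dual_scaleR[of F x "-1"] by simp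

lemma dual_diff: "F \<in> dual \<Longrightarrow> x \<in> c0 I \<Longrightarrow> y \<in> c0 I \<Longrightarrow> F (x - y) = F x - F y"
  using dual_add[of F x "- y"] dual_minus[of F y] c0_scaleR[of y "-1"] by simp

lemma dual_zero: "F \<in> dual \<Longrightarrow> F 0 = 0"
  using dual_scaleR[of F 0 0] c0_zero by simp

lemma dual_bounded:
  assumes "F \<in> dual"
  obtains K where "0 < K" "\<And>x. x \<in> c0 I \<Longrightarrow> \<bar>F x\<bar> \<le> K * norm x"
proof -
  obtain K where K: "\<And>x. x \<in> c0 I \<Longrightarrow> \<bar>F x\<bar> \<le> K * norm x"
    using assms unfolding dual_space_def by blast
  have "\<bar>F x\<bar> \<le> max 1 K * norm x" if "x \<in> c0 I" for x
    using K[OF that] mult_right_mono[of K "max 1 K" "norm x"] by simp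
  then show thesis using that[of "max 1 K"] by simp
qed

lemma tv_least: "(\<And>d. 0 \<le> g d) \<Longrightarrow> (\<And>y. y \<in> c0 I \<Longrightarrow> (\<And>d. \<bar>val y d\<bar> \<le> g d) \<Longrightarrow> F y \<le> b) \<Longrightarrow> tv F g \<le> b"
  unfolding tv_def by (rule cSUP_least) (auto intro: exI[of _ 0] simp: c0_zero)

lemma tv_upper:
  assumes "F \<in> dual" "\<And>d. g d \<le> B" "y \<in> c0 I" "\<And>d. \<bar>val y d\<bar> \<le> g d"
  shows "F y \<le> tv F g"
  unfolding tv_def
proof (rule cSUP_upper)
  obtain K where K: "0 < K" "\<And>x. x \<in> c0 I \<Longrightarrow> \<bar>F x\<bar> \<le> K * norm x"
    using dual_bounded[OF assms(1)] by blast
  show "bdd_above (F ` {y \<in> c0 I. \<forall>d. \<bar>val y d\<bar> \<le> g d})"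
  proof (rule bdd_aboveI2)
    fix y assume y: "y \<in> {y \<in> c0 I. \<forall>d. \<bar>val y d\<bar> \<le> g d}"
    then have "norm y \<le> B" using assms(2) by (intro norm_leI) (auto intro: order_trans)
    then have "K * norm y \<le> K * B" using K(1) by (intro mult_left_mono) simp_all
    then show "F y \<le> K * B" using K(2)[of y] y by auto
  qed
qed (use assms in auto)

lemma tv_abs_upper:
  assumes "F \<in> dual" "\<And>d. g d \<le> B" "y \<in> c0 I" "\<And>d. \<bar>val y d\<bar> \<le> g d"
  shows "\<bar>F y\<bar> \<le> tv F g"
proof -
  have "- y \<in> c0 I" using assms(3) c0_scaleR[of y "-1"] by simp
  then have "F (- y) \<le> tv F g" using tv_upper[OF assms(1,2)] assms(4) by simp
  then show ?thesis using tv_upper[OF assms] dual_minus[OF assms(1,3)] by linarith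
qed

lemma tv_nonneg: "F \<in> dual \<Longrightarrow> (\<And>d. 0 \<le> g d) \<Longrightarrow> (\<And>d. g d \<le> B) \<Longrightarrow> 0 \<le> tv F g"
  using tv_upper[of F g B 0] by (simp add: c0_zero dual_zero)

lemma tv_mono:
  assumes "F \<in> dual" "\<And>d. 0 \<le> g d" "\<And>d. g d \<le> h d" "\<And>d. h d \<le> B"
  shows "tv F g \<le> tv F h"
  using assms by (intro tv_least tv_upper[where B = B]) (auto intro: order_trans[OF _ assms(3)])

lemma tv_le_bound:
  assumes "\<And>x. x \<in> c0 I \<Longrightarrow> \<bar>F x\<bar> \<le> C * norm x" "0 \<le> C" "\<And>d. 0 \<le> g d" "\<And>d. g d \<le> B"
  shows "tv F g \<le> C * B"
proof (rule tv_least)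
  fix y assume y: "y \<in> c0 I" "\<And>d. \<bar>val y d\<bar> \<le> g d"
  then have "norm y \<le> B" using assms(4) by (intro norm_leI) (auto intro: order_trans)
  then show "F y \<le> C * B" using assms(1)[OF y(1)] mult_left_mono[OF _ assms(2)] by fastforce
qed fact

text \<open>
  Additivity is the Riesz decomposition property: a \<open>y\<close> with \<open>|y| \<le> g + h\<close> is the sum of its truncation
  \<open>u\<close> to \<open>[-g, g]\<close> and a remainder bounded by \<open>h\<close>, and solidity of \<open>c0 I\<close> keeps both parts in the space.
\<close>

lemma tv_add:
  assumes F: "F \<in> dual" and g: "\<And>d. 0 \<le> g d" "\<And>d. g d \<le> B"
    and h: "\<And>d. 0 \<le> h d" "\<And>d. h d \<le> B'"
  shows "tv F (\<lambda>d. g d + h d) = tv F g + tv F h"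
proof (rule antisym)
  have gh: "g d + h d \<le> B + B'" for d using g(2)[of d] h(2)[of d] by simp
  show "tv F (\<lambda>d. g d + h d) \<le> tv F g + tv F h"
  proof (rule tv_least)
    fix y assume y: "y \<in> c0 I" "\<And>d. \<bar>val y d\<bar> \<le> g d + h d"
    define u where "u = bfun (\<lambda>d. max (- g d) (min (g d) (val y d)))"
    have val_u: "val u d = max (- g d) (min (g d) (val y d))" for d
      unfolding u_def using g(1) g(2)
      by (intro val_bfun[where K = B]) (smt (verit))
    have u: "u \<in> c0 I"
      by (rule c0_solid[OF y(1)]) (use g(1) val_u in \<open>smt (verit)\<close>)
    have "F u \<le> tv F g" by (rule tv_upper[OF F g(2) u]) (use g(1) val_u in \<open>smt (verit)\<close>)
    moreover have "F (y - u) \<le> tv F h"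
    proof (rule tv_upper[OF F h(2) c0_diff[OF y(1) u]])
      show "\<bar>val (y - u) d\<bar> \<le> h d" for d
        using val_u[of d] g(1)[of d] h(1)[of d] y(2)[of d] by simp
    qed
    ultimately show "F y \<le> tv F g + tv F h" using dual_diff[OF F y(1) u] by simp
  qed (use g(1) h(1) in auto)
  have "tv F h \<le> tv F (\<lambda>d. g d + h d) - F x" if x: "x \<in> c0 I" "\<And>d. \<bar>val x d\<bar> \<le> g d" for x
  proof (rule tv_least)
    fix y assume y: "y \<in> c0 I" "\<And>d. \<bar>val y d\<bar> \<le> h d"
    have "F (x + y) \<le> tv F (\<lambda>d. g d + h d)"
    proof (rule tv_upper[OF F gh c0_add[OF x(1) y(1)]])
      show "\<bar>val (x + y) d\<bar> \<le> g d + h d" for d using x(2)[of d] y(2)[of d] by simp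
    qed
    then show "F y \<le> tv F (\<lambda>d. g d + h d) - F x" using dual_add[OF F x(1) y(1)] by simp
  qed fact
  then have "tv F g \<le> tv F (\<lambda>d. g d + h d) - tv F h"
    by (intro tv_least g(1)) (simp add: algebra_simps)
  then show "tv F g + tv F h \<le> tv F (\<lambda>d. g d + h d)" by simp
qed

lemma tv_scale:
  assumes F: "F \<in> dual" and g: "\<And>d. 0 \<le> g d" "\<And>d. g d \<le> B" and "0 < c"
  shows "tv F (\<lambda>d. c * g d) = c * tv F g"
proof (rule antisym)
  have scale_le: "tv F (\<lambda>d. a * h d) \<le> a * tv F h"
    if "0 < a" "\<And>d. 0 \<le> h d" "\<And>d. h d \<le> B'" for a B' h
  proof (rule tv_least)
    fix y assume y: "y \<in> c0 I" "\<And>d. \<bar>val y d\<bar> \<le> a * h d"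
    have "F ((1 / a) *\<^sub>R y) \<le> tv F h"
      by (rule tv_upper[OF F that(3)]) (use y that(1) in \<open>auto simp: c0_scaleR abs_mult field_simps\<close>)
    then show "F y \<le> a * tv F h"
      using dual_scaleR[OF F y(1), of "1 / a"] that(1) by (simp add: field_simps)
  qed (use that in auto)
  show "tv F (\<lambda>d. c * g d) \<le> c * tv F g" using scale_le[OF \<open>0 < c\<close> g] .
  have "tv F (\<lambda>d. (1 / c) * (c * g d)) \<le> (1 / c) * tv F (\<lambda>d. c * g d)"
    using g \<open>0 < c\<close> by (intro scale_le[where B' = "c * B"]) auto
  then show "c * tv F g \<le> tv F (\<lambda>d. c * g d)" using \<open>0 < c\<close> by (simp add: field_simps)
qed

lemma tv_witness:
  assumes "\<And>d. 0 \<le> g d" "b < tv F g"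
  obtains y where "y \<in> c0 I" "\<And>d. \<bar>val y d\<bar> \<le> g d" "b < F y"
  using assms tv_least[of g F b] by (meson not_le)

lemma abs_le_tv_norm:
  assumes "F \<in> dual" "x \<in> c0 I"
  shows "\<bar>F x\<bar> \<le> tv F (\<lambda>_. 1) * norm x"
proof (cases "x = 0")
  case False
  have "\<bar>F ((1 / norm x) *\<^sub>R x)\<bar> \<le> tv F (\<lambda>_. 1)"
    by (rule tv_abs_upper[OF assms(1) order_refl])
       (use False abs_val_le_norm[of x] in \<open>auto simp: c0_scaleR assms(2) field_simps\<close>)
  then show ?thesis using False by (simp add: dual_scaleR assms abs_mult field_simps)
qed (use dual_zero assms in auto)

lemma tv_content:
  assumes "F \<in> dual" "0 \<le> C" "\<And>x. x \<in> c0 I \<Longrightarrow> \<bar>F x\<bar> \<le> C * norm x"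
  shows "bounded_content (\<lambda>A. tv F (indicator A)) C"
  unfolding bounded_content_def
proof (intro conjI allI impI)
  fix A B :: "'d set" assume "A \<inter> B = {}"
  then have "(indicator (A \<union> B) :: 'd \<Rightarrow> real) = (\<lambda>d. indicator A d + indicator B d)"
    by (auto simp: fun_eq_iff indicator_def)
  then show "tv F (indicator (A \<union> B)) = tv F (indicator A) + tv F (indicator B)"
    using tv_add[OF assms(1), of "indicator A" 1 "indicator B" 1] by (simp add: indicator_def)
next
  fix A :: "'d set"
  show "0 \<le> tv F (indicator A)" by (rule tv_nonneg[OF assms(1), where B = 1]) (auto simp: indicator_def)
  show "tv F (indicator A) \<le> C"
    using tv_le_bound[OF assms(3,2), of "indicator A" 1] by (simp add: indicator_def)
qed

section \<open>Uniform boundedness\<close>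

text \<open>
  Every ball of radius \<open>r\<close> contains a point where \<open>|F|\<close> is at least \<open>r\<close> times its value at a given unit
  vector, because \<open>F x + r F u\<close> and \<open>F x - r F u\<close> cannot both be small.
\<close>

lemma dual_large_nearby:
  assumes F: "F \<in> dual" and "x \<in> c0 I" "u \<in> c0 I" "norm u \<le> 1" "0 < r"
  obtains x' where "x' \<in> c0 I" "norm (x' - x) \<le> r" "r * F u \<le> \<bar>F x'\<bar>"
proof -
  have ru: "r *\<^sub>R u \<in> c0 I" using assms c0_scaleR by blast
  have "F (x + r *\<^sub>R u) = F x + r * F u" "F (x - r *\<^sub>R u) = F x - r * F u"
    using dual_add[OF F assms(2) ru] dual_diff[OF F assms(2) ru] dual_scaleR[OF F assms(3)]
    by auto
  then have "r * F u \<le> \<bar>F (x + r *\<^sub>R u)\<bar> \<or> r * F u \<le> \<bar>F (x - r *\<^sub>R u)\<bar>" by linarith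
  then show thesis
  proof
    assume "r * F u \<le> \<bar>F (x + r *\<^sub>R u)\<bar>"
    then show thesis
      using that[of "x + r *\<^sub>R u"] c0_add[OF assms(2) ru] assms(4,5) by (simp add: mult_left_le)
  next
    assume "r * F u \<le> \<bar>F (x - r *\<^sub>R u)\<bar>"
    then show thesis
      using that[of "x - r *\<^sub>R u"] c0_diff[OF assms(2) ru] assms(4,5) by (simp add: mult_left_le)
  qed
qed

text \<open>
  The uniform boundedness principle, by a gliding hump that avoids Baire category: if the norms were
  unbounded, the step with number \<open>i\<close> could move by at most \<open>(1/3)\<^sup>i\<close> to a point such that some \<open>|F n|\<close>
  stays above \<open>i\<close> on the ball of radius \<open>(1/3)\<^sup>i / 2\<close> around it. All later steps together stay inside
  that ball, so the sequence \<open>F n l\<close> would be unbounded at the limit \<open>l\<close>.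
\<close>

lemma weak_star_null_bounded:
  assumes F: "\<And>n. F n \<in> dual" and null: "weak_star_null (c0 I) F"
  obtains C where "0 < C" "\<And>n x. x \<in> c0 I \<Longrightarrow> \<bar>F n x\<bar> \<le> C * norm x"
proof (rule ccontr)
  assume "\<not> thesis"
  with that have unbounded: "\<exists>n x. x \<in> c0 I \<and> \<not> \<bar>F n x\<bar> \<le> C * norm x" if "0 < C" for C
    using \<open>0 < C\<close> by blast
  have unbounded_tv: "\<exists>n. C < tv (F n) (\<lambda>_. 1)" if "0 < C" for C
  proof (rule ccontr)
    assume "\<not> ?thesis"
    then have "\<bar>F n x\<bar> \<le> C * norm x" if "x \<in> c0 I" for n x
      using abs_le_tv_norm[OF F that] mult_right_mono[of "tv (F n) (\<lambda>_. 1)" C "norm x"]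
      by (meson norm_ge_zero not_le order_trans)
    then show False using unbounded[OF \<open>0 < C\<close>] by blast
  qed
  define P where "P i q \<longleftrightarrow> fst q \<in> c0 I" for i :: nat and q :: "'d l_infty \<times> nat"
  define Q where "Q i q q' \<longleftrightarrow> norm (fst q' - fst q) \<le> (1/3) ^ i \<and>
      (\<forall>y\<in>c0 I. norm (y - fst q') \<le> (1/3) ^ i / 2 \<longrightarrow> real i \<le> \<bar>F (snd q') y\<bar>)"
    for i and q q' :: "'d l_infty \<times> nat"
  have "\<exists>q. P 0 q" using c0_zero by (auto simp: P_def)
  moreover have "\<exists>q'. P (Suc i) q' \<and> Q i q q'" if Pq: "P i q" for q i
  proof -
    define r :: real where "r = (1/3) ^ i"
    have r: "0 < r" by (simp add: r_def)
    \<comment> \<open>A gain of \<open>r * 4/5 * K\<close> at the centre beats the oscillation \<open>K * r / 2\<close> on the ball by \<open>3/10 * r * K\<close>, which exceeds \<open>i\<close>.\<close>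
    have "0 < 5 * (real i + 1) / r" using r by simp
    then obtain n where n: "5 * (real i + 1) / r < tv (F n) (\<lambda>_. 1)" using unbounded_tv by blast
    define K where "K = tv (F n) (\<lambda>_. 1)"
    have "0 < K" using n \<open>0 < 5 * (real i + 1) / r\<close> unfolding K_def by (rule less_trans[rotated])
    moreover have "5 * (real i + 1) < r * K" using n r unfolding K_def by (simp add: field_simps)
    ultimately have K: "0 < K" "5 * (real i + 1) < r * K" by blast+
    then obtain u where u: "u \<in> c0 I" "\<And>d. \<bar>val u d\<bar> \<le> 1" "4/5 * K < F n u"
      using tv_witness[of "\<lambda>_. 1" "4/5 * K" "F n"] unfolding K_def by auto
    have "norm u \<le> 1" using u(2) by (rule norm_leI)
    obtain x' where x': "x' \<in> c0 I" "norm (x' - fst q) \<le> r" "r * F n u \<le> \<bar>F n x'\<bar>"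
      using dual_large_nearby[OF F _ u(1) \<open>norm u \<le> 1\<close> r] Pq unfolding P_def by metis
    have "real i \<le> \<bar>F n y\<bar>" if y: "y \<in> c0 I" "norm (y - x') \<le> r / 2" for y
    proof -
      have "\<bar>F n y - F n x'\<bar> \<le> K * norm (y - x')"
        using abs_le_tv_norm[OF F[of n] c0_diff[OF y(1) x'(1)]]
          dual_diff[OF F y(1) x'(1)] by (simp add: K_def)
      also have "\<dots> \<le> K * (r / 2)" using y K(1) by (intro mult_left_mono) auto
      finally have "r * F n u - K * (r / 2) \<le> \<bar>F n y\<bar>" using x'(3) by linarith
      moreover have "r * (4/5 * K) \<le> r * F n u" using u(3) r by (intro mult_left_mono) auto
      ultimately show ?thesis using K(2) by (simp add: field_simps)
    qed
    then show ?thesis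
      using x' by (intro exI[of _ "(x', n)"]) (auto simp: P_def Q_def r_def)
  qed
  ultimately obtain q where q: "\<And>i. P i (q i)" "\<And>i. Q i (q i) (q (Suc i))"
    using dependent_nat_choice[of P Q] by blast
  define x where "x i = fst (q i)" for i
  define m where "m i = snd (q (Suc i))" for i
  have x: "x i \<in> c0 I" "norm (x (Suc i) - x i) \<le> (1/3) ^ i" for i
    using q[of i] by (auto simp: x_def P_def Q_def)
  have step: "norm (x (i + k) - x i) \<le> (1/3) ^ i * (3/2) * (1 - (1/3) ^ k)" for i k
  proof (induction k)
    case (Suc k)
    have "norm (x (i + Suc k) - x i) \<le> norm (x (i + Suc k) - x (i + k)) + norm (x (i + k) - x i)"
      by (metis norm_triangle_ineq diff_add_cancel add_diff_eq)
    also have "\<dots> \<le> (1/3) ^ (i + k) + (1/3) ^ i * (3/2) * (1 - (1/3) ^ k)"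
      using Suc x(2)[of "i + k"] by simp
    also have "\<dots> = (1/3) ^ i * (3/2) * (1 - (1/3) ^ Suc k)" by (simp add: power_add field_simps)
    finally show ?case .
  qed simp
  have step': "norm (x (i + k) - x i) \<le> (1/3) ^ i * (3/2)" for i k
    using step[of i k] by (rule order_trans) (rule mult_left_le, simp_all)
  have "Cauchy x"
  proof (rule CauchyI')
    fix e :: real assume "0 < e"
    obtain M where M: "(1/3 :: real) ^ M < e / 2" using real_arch_pow_inv[of "e/2" "1/3"] \<open>0 < e\<close> by auto
    show "\<exists>M. \<forall>i\<ge>M. \<forall>n>i. dist (x i) (x n) < e"
    proof (intro exI[of _ M] allI impI)
      fix i n assume in': "M \<le> i" "i < n"
      have "norm (x n - x i) \<le> (1/3) ^ i * (3/2)" using step'[of i "n - i"] in' by simp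
      also have "\<dots> \<le> (1/3) ^ M * (3/2)" using power_decreasing[OF in'(1), of "1/3 :: real"] by simp
      also have "\<dots> < e" using M \<open>0 < e\<close> by simp
      finally show "dist (x i) (x n) < e" by (simp add: dist_norm norm_minus_commute)
    qed
  qed
  then obtain l where l: "l \<in> c0 I" "x \<longlonglongrightarrow> l"
    using banach_subspace_c0 x(1) unfolding banach_subspace_def complete_def by blast
  have big: "real i \<le> \<bar>F (m i) l\<bar>" for i
  proof -
    have "norm (l - x (Suc i)) \<le> (1/3) ^ Suc i * (3/2)"
    proof (rule LIMSEQ_le_const2)
      show "(\<lambda>k. norm (x (k + Suc i) - x (Suc i))) \<longlonglongrightarrow> norm (l - x (Suc i))"
        by (intro tendsto_intros LIMSEQ_ignore_initial_segment l(2))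
      show "\<exists>N. \<forall>k\<ge>N. norm (x (k + Suc i) - x (Suc i)) \<le> (1/3) ^ Suc i * (3/2)"
        using step'[of "Suc i"] by (metis add.commute)
    qed
    then show ?thesis using q(2)[of i] l(1) by (simp add: Q_def m_def x_def)
  qed
  have "Bseq (\<lambda>n. F n l)"
    using null l(1) by (intro convergent_imp_Bseq convergentI[of _ 0]) (simp add: weak_star_null_def)
  then obtain B where B: "\<And>n. \<bar>F n l\<bar> \<le> B" unfolding Bseq_def real_norm_def by blast
  obtain i where "B < real i" using reals_Archimedean2 by blast
  then show False using big[of i] B[of "m i"] by simp
qed

section \<open>Gliding humps\<close>

lemma cut_disjoint_Un:
  assumes "F \<in> dual" "z \<in> c0 I" "A \<inter> B = {}"
  shows "F (cut (A \<union> B) z) = F (cut A z) + F (cut B z)"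
proof -
  have "cut (A \<union> B) z = cut A z + cut B z"
    by (rule val_eqI) (use assms(3) in \<open>auto simp: indicator_def\<close>)
  then show ?thesis using dual_add[OF assms(1) c0_cut c0_cut] assms(2) by simp
qed

lemma abs_cut_le:
  assumes "F \<in> dual" "z \<in> c0 I" "norm z \<le> 1"
  shows "\<bar>F (cut A z)\<bar> \<le> tv F (indicator A)"
proof (rule tv_abs_upper[OF assms(1) _ c0_cut[OF assms(2)], where B = 1])
  show "\<bar>val (cut A z) d\<bar> \<le> indicator A d" for d
    using abs_val_le_norm[of z d] assms(3) by (simp add: indicator_def)
qed (simp add: indicator_def)

text \<open>
  Since \<open>z\<close> is fixed, \<open>T \<mapsto> F k (cut (\<Union>j\<in>T. B j) z)\<close> is a bounded finitely additive
  set function on all subsets of the index set, which tends to \<open>0\<close> as \<open>k\<close> grows. If it kept mass \<open>\<epsilon>\<close> at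
  the singletons \<open>{k}\<close>, one could pick indices \<open>k i\<close> together with decreasing infinite sets \<open>N i\<close> of
  candidates for the later indices such that the earlier indices contribute little (pointwise
  convergence) and all of \<open>N i\<close> contributes little (enough disjoint infinite sets of
  candidates compete for a finite variation). The set \<open>T\<close> of all indices picked then violates the
  convergence to \<open>0\<close>.
\<close>

lemma phillips_disjoint:
  assumes F: "\<And>n. F n \<in> dual" and null: "weak_star_null (c0 I) F"
    and z: "z \<in> c0 I" "norm z \<le> 1" and disj: "disjoint_family B" and "0 < \<epsilon>"
  shows "\<exists>k. \<bar>F k (cut (B k) z)\<bar> < \<epsilon>"
proof (rule ccontr)
  assume "\<not> ?thesis"
  then have big: "\<epsilon> \<le> \<bar>F k (cut (B k) z)\<bar>" for k by (simp add: not_less)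
  define U where "U S = (\<Union>j\<in>S. B j)" for S
  have U_disj: "U S \<inter> U T = {}" if "S \<inter> T = {}" for S T
  proof (rule equals0I)
    fix d assume "d \<in> U S \<inter> U T"
    then obtain i j where "i \<in> S" "j \<in> T" "d \<in> B i \<inter> B j" by (auto simp: U_def)
    moreover have "i \<noteq> j" using that \<open>i \<in> S\<close> \<open>j \<in> T\<close> by blast
    ultimately show False using disjoint_family_onD[OF disj, of i j] by simp
  qed
  have small: "eventually (\<lambda>n. \<bar>F n (cut (U S) z)\<bar> < \<epsilon> / 4) sequentially" for S
  proof -
    have "(\<lambda>n. F n (cut (U S) z)) \<longlonglongrightarrow> 0"
      using null c0_cut[OF z(1)] by (simp add: weak_star_null_def)
    then show ?thesis using \<open>0 < \<epsilon>\<close> by (auto simp: tendsto_iff dist_real_def dest: spec[of _ "\<epsilon> / 4"])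
  qed
  have shrink: "\<exists>M\<subseteq>N. infinite M \<and> tv (F k) (indicator (U M)) \<le> \<epsilon> / 4"
    if N: "infinite N" for k and N :: "nat set"
  proof -
    obtain K where K: "0 < K" "\<And>x. x \<in> c0 I \<Longrightarrow> \<bar>F k x\<bar> \<le> K * norm x" using dual_bounded[OF F] by blast
    obtain p :: nat where p: "4 * K / \<epsilon> < real p" using reals_Archimedean2 by blast
    have "0 < p" using p K(1) \<open>0 < \<epsilon>\<close> by (cases "p = 0") (simp_all add: field_simps)
    obtain r :: "nat \<Rightarrow> nat" where r: "strict_mono r" "\<And>i. r i \<in> N"
      using infinite_enumerate[OF N] by blast
    then have "inj r" by (simp add: strict_mono_imp_inj_on)
    \<comment> \<open>The residue classes of the indices split a sequence in \<open>N\<close> into \<open>p\<close> disjoint infinite sets, one of which has variation at most \<open>K / p\<close>.\<close>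
    define M where "M j = r ` {i. i mod p = j}" for j
    have M_disj: "M i \<inter> M j = {}" if "i \<noteq> j" for i j
      using that \<open>inj r\<close> by (auto simp: M_def dest: injD)
    have "disjoint_family_on (\<lambda>j. U (M j)) {..<p}"
      unfolding disjoint_family_on_def using U_disj M_disj by blast
    then obtain j where j: "j < p" "tv (F k) (indicator (U (M j))) \<le> K / real p"
      using content_pigeonhole[OF tv_content[OF F[of k] less_imp_le[OF K(1)] K(2)]] \<open>0 < p\<close> by blast
    have "K / real p \<le> \<epsilon> / 4" using p \<open>0 < p\<close> \<open>0 < \<epsilon>\<close> by (simp add: field_simps)
    moreover have "infinite (M j)"
    proof -
      have "infinite {i. i mod p = j}"
      proof
        assume "finite {i. i mod p = j}"
        moreover have "range (\<lambda>i. j + p * i) \<subseteq> {i. i mod p = j}" using j(1) by auto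
        moreover have "infinite (range (\<lambda>i. j + p * i))"
          using \<open>0 < p\<close> by (intro range_inj_infinite injI) simp
        ultimately show False using finite_subset by blast
      qed
      then show ?thesis
        unfolding M_def using finite_imageD[OF _ inj_on_subset[OF \<open>inj r\<close> subset_UNIV]] by blast
    qed
    moreover have "M j \<subseteq> N" using r(2) by (auto simp: M_def)
    ultimately show ?thesis using order_trans[OF j(2)] by blast
  qed
  \<comment> \<open>A state consists of the earlier indices \<open>S\<close>, the current index \<open>k\<close> and the candidates \<open>N\<close> for the later ones.\<close>
  define P where "P i q \<longleftrightarrow> (case q of (S, k, N) \<Rightarrow> finite S \<and> infinite N \<and> (\<forall>j\<in>insert k S. \<forall>n\<in>N. j < n) \<and>
      k \<notin> S \<and> \<bar>F k (cut (U S) z)\<bar> < \<epsilon> / 4 \<and> tv (F k) (indicator (U N)) \<le> \<epsilon> / 4)"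
    for i :: nat and q :: "nat set \<times> nat \<times> nat set"
  define Q where "Q i q q' \<longleftrightarrow> (case (q, q') of ((S, k, N), (S', k', N')) \<Rightarrow>
      S' = insert k S \<and> k' \<in> N \<and> N' \<subseteq> N)"
    for i :: nat and q q' :: "nat set \<times> nat \<times> nat set"
  have step: "\<exists>k\<in>N. \<exists>N'\<subseteq>N. P i (S, k, N')"
    if S: "finite S" "infinite N" "\<forall>j\<in>S. \<forall>n\<in>N. j < n" for S N i
  proof -
    obtain n0 where n0: "\<And>n. n0 \<le> n \<Longrightarrow> \<bar>F n (cut (U S) z)\<bar> < \<epsilon> / 4"
      using small[of S] by (auto simp: eventually_sequentially)
    obtain k where k: "k \<in> N" "n0 \<le> k" using S(2) by (meson infinite_nat_iff_unbounded_le)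
    have "infinite (N - {..k})" using S(2) by simp
    then obtain M where M: "M \<subseteq> N - {..k}" "infinite M" "tv (F k) (indicator (U M)) \<le> \<epsilon> / 4"
      using shrink by blast
    have "P i (S, k, M)" unfolding P_def using M S k n0[of k] by auto
    then show ?thesis using k M(1) by blast
  qed
  have "\<exists>q. P 0 q" using step[of "{}" UNIV 0] by auto
  moreover have "\<exists>q'. P (Suc i) q' \<and> Q i q q'" if Pq: "P i q" for q i
  proof -
    obtain S k N where q: "q = (S, k, N)" by (cases q)
    obtain k' N' where "k' \<in> N" "N' \<subseteq> N" "P (Suc i) (insert k S, k', N')"
      using step[of "insert k S" N "Suc i"] Pq unfolding q P_def by auto
    then show ?thesis unfolding q Q_def by (intro exI[of _ "(insert k S, k', N')"]) simp
  qed
  ultimately obtain q where q: "\<And>i. P i (q i)" "\<And>i. Q i (q i) (q (Suc i))"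
    using dependent_nat_choice[of P Q] by blast
  define S where "S i = fst (q i)" for i
  define k where "k i = fst (snd (q i))" for i
  define N where "N i = snd (snd (q i))" for i
  have q_eq: "q i = (S i, k i, N i)" for i by (simp add: S_def k_def N_def)
  have P: "finite (S i)" "\<And>j n. j \<in> insert (k i) (S i) \<Longrightarrow> n \<in> N i \<Longrightarrow> j < n" "k i \<notin> S i"
    "\<bar>F (k i) (cut (U (S i)) z)\<bar> < \<epsilon> / 4" "tv (F (k i)) (indicator (U (N i))) \<le> \<epsilon> / 4" for i
    using q(1)[of i] unfolding P_def q_eq by auto
  have Q: "S (Suc i) = insert (k i) (S i)" "k (Suc i) \<in> N i" "N (Suc i) \<subseteq> N i" for i
    using q(2)[of i] unfolding Q_def q_eq by auto
  have N_antimono: "N j \<subseteq> N i" if "i \<le> j" for i j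
    using that Q(3) by (rule lift_Suc_antimono_le[rotated])
  have k_in_N: "k j \<in> N i" if "i < j" for i j
  proof -
    have "i \<le> j - 1" "Suc (j - 1) = j" using that by simp_all
    then show ?thesis using Q(2)[of "j - 1"] N_antimono by auto
  qed
  have S_subset: "S i \<subseteq> S 0 \<union> range k" for i
  proof (induction i)
    case (Suc i)
    then show ?case unfolding Q(1) by blast
  qed blast
  have S_mono: "S i \<subseteq> S j" if "i \<le> j" for i j
    by (rule lift_Suc_mono_le[of S, OF _ that]) (unfold Q(1), rule subset_insertI)
  define T where "T = S 0 \<union> range k"
  \<comment> \<open>Seen from \<open>k i\<close>, the set \<open>T\<close> consists of the past, the present, and a future inside \<open>N i\<close>.\<close>
  have T_split: "T = S i \<union> {k i} \<union> (T \<inter> N i)" for i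
  proof -
    have "k j \<in> S i \<union> {k i} \<union> N i" for j
    proof -
      consider "j < i" | "j = i" | "i < j" by linarith
      then show ?thesis
      proof cases
        case 1
        then have "k j \<in> S (Suc j)" "S (Suc j) \<subseteq> S i" using Q(1)[of j] S_mono[of "Suc j" i] by auto
        then show ?thesis by blast
      qed (use k_in_N in auto)
    qed
    then show ?thesis using S_subset[of i] S_mono[of 0 i] unfolding T_def by blast
  qed
  have T_big: "\<epsilon> / 2 \<le> \<bar>F (k i) (cut (U T) z)\<bar>" for i
  proof -
    let ?R = "T \<inter> N i"
    have "S i \<inter> {k i} = {}" "(S i \<union> {k i}) \<inter> ?R = {}" using P(2)[of _ i] P(3)[of i] by force+
    moreover have "U (A \<union> A') = U A \<union> U A'" for A A' by (auto simp: U_def)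
    ultimately have "F (k i) (cut (U (S i \<union> {k i} \<union> ?R)) z)
        = F (k i) (cut (U (S i)) z) + F (k i) (cut (U {k i}) z) + F (k i) (cut (U ?R) z)"
      using cut_disjoint_Un[OF F z(1)] U_disj by metis
    moreover have "\<bar>F (k i) (cut (U ?R) z)\<bar> \<le> \<epsilon> / 4"
    proof -
      have "\<bar>F (k i) (cut (U ?R) z)\<bar> \<le> tv (F (k i)) (indicator (U ?R))" by (rule abs_cut_le[OF F z])
      also have "\<dots> \<le> tv (F (k i)) (indicator (U (N i)))"
        by (rule tv_mono[OF F, where B = 1]) (auto simp: indicator_def U_def)
      finally show ?thesis using P(5)[of i] by simp
    qed
    moreover have "U {k i} = B (k i)" by (simp add: U_def)
    moreover have "F (k i) (cut (U T) z) = F (k i) (cut (U (S i \<union> {k i} \<union> ?R)) z)"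
      using T_split[of i] by (rule arg_cong)
    ultimately show ?thesis using big[of "k i"] P(4)[of i] by (simp add: abs_if split: if_splits)
  qed
  have "strict_mono k" using P(2) Q(2) by (auto simp: strict_mono_Suc_iff)
  then obtain i where "\<bar>F (k i) (cut (U T) z)\<bar> < \<epsilon> / 4"
    using eventually_subseq[OF _ small[of T]] eventually_happens by fastforce
  then show False using T_big[of i] \<open>0 < \<epsilon>\<close> by simp
qed

end

section \<open>Uniform exhaustivity\<close>

text \<open>
  The index sequence \<open>n\<close> is arbitrary, so this says that \<open>\<mu> n (A k)\<close> tends to \<open>0\<close> as \<open>k\<close> grows,
  uniformly in \<open>n\<close>, for every disjoint sequence \<open>A\<close> in \<open>I\<close>.
\<close>

definition uniformly_exhaustive :: "'a set set \<Rightarrow> (nat \<Rightarrow> 'a set \<Rightarrow> real) \<Rightarrow> bool" where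
  "uniformly_exhaustive I \<mu> \<longleftrightarrow>
     (\<forall>A n \<epsilon>. disjoint_family A \<and> (\<forall>k. A k \<in> I) \<and> 0 < \<epsilon> \<longrightarrow> (\<exists>k :: nat. \<mu> (n k) (A k) < (\<epsilon> :: real)))"

lemma disjoint_family_increasing_differences:
  assumes "\<And>i j :: nat. i \<le> j \<Longrightarrow> K i \<subseteq> K j"
  shows "disjoint_family (\<lambda>i. K (Suc i) - K i)"
proof -
  have "(K (Suc i) - K i) \<inter> (K (Suc j) - K j) = {}" if "i < j" for i j
    using assms[of "Suc i" j] that by auto
  then show ?thesis
    unfolding disjoint_family_on_def by (metis Int_commute linorder_neqE_nat)
qed

lemma disjoint_family_decreasing_differences:
  assumes "\<And>i j :: nat. i \<le> j \<Longrightarrow> L j \<subseteq> L i"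
  shows "disjoint_family (\<lambda>i. L i - L (Suc i))"
proof -
  have "(L i - L (Suc i)) \<inter> (L j - L (Suc j)) = {}" if "i < j" for i j
    using assms[of "Suc i" j] that by auto
  then show ?thesis
    unfolding disjoint_family_on_def by (metis Int_commute linorder_neqE_nat)
qed

text \<open>
  Uniform absolute continuity: sets that become negligible for each \<open>\<mu> i\<close> separately cannot
  remain large for varying \<open>\<mu> (n k)\<close>. For countably additive measures one would pass to the limit superior of
  the \<open>E k\<close>. Here exhaustivity supplies a substitute: up to a uniformly small error the infinite union of
  \<open>E k, E (k + 1), ...\<close> is already a finite union \<open>H k (m k)\<close>, and the finite intersections \<open>L k\<close> of these
  finite unions decrease. They carry mass \<open>\<epsilon> / 2\<close> under \<open>\<mu> (n k)\<close>, but for fixed \<open>i\<close> the mass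
  \<open>\<mu> i (L k)\<close> tends to \<open>0\<close>, so that successive differences of a subsequence are disjoint and carry
  mass \<open>\<epsilon> / 4\<close> each.
\<close>

lemma uniformly_exhaustive_imp_uniformly_small:
  fixes \<mu> :: "nat \<Rightarrow> 'a set \<Rightarrow> real"
  assumes "set_ideal I" and content: "\<And>i. bounded_content (\<mu> i) C"
    and exh: "uniformly_exhaustive I \<mu>"
    and E: "\<And>k. E k \<in> I" and sum: "\<And>i. summable (\<lambda>k. \<mu> i (E k))" and "0 < \<epsilon>"
  shows "\<exists>k. \<mu> (n k) (E k) < \<epsilon>"
proof (rule ccontr)
  assume "\<not> ?thesis"
  then have big: "\<epsilon> \<le> \<mu> (n k) (E k)" for k by (simp add: not_less)
  interpret c0_ideal I by standard fact
  define H where "H k m = (\<Union>j\<in>{k..m}. E j)" for k m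
  have H_I: "H k m \<in> I" for k m unfolding H_def using E by (intro set_ideal_finite_UN[OF ideal]) auto
  have H_mono: "H k m \<subseteq> H k m'" if "m \<le> m'" for k m m' unfolding H_def using that by (intro UN_mono) auto
  \<comment> \<open>Otherwise the differences of a subsequence of the increasing sets \<open>H k m\<close> would be disjoint and large.\<close>
  have stable: "\<exists>m\<ge>k. \<forall>m'\<ge>m. \<forall>i. \<mu> i (H k m' - H k m) < e" if "0 < e" for k e
  proof (rule ccontr)
    assume "\<not> ?thesis"
    then have unstable: "\<exists>m'\<ge>m. \<exists>i. e \<le> \<mu> i (H k m' - H k m)" if "k \<le> m" for m
      using that by (auto simp: not_less)
    have "\<exists>f. \<forall>j. k \<le> f j \<and> (f j \<le> f (Suc j) \<and> (\<exists>i. e \<le> \<mu> i (H k (f (Suc j)) - H k (f j))))"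
    proof (rule dependent_nat_choice)
      fix m j assume "k \<le> m"
      with unstable[OF this] show "\<exists>m'. k \<le> m' \<and> m \<le> m' \<and> (\<exists>i. e \<le> \<mu> i (H k m' - H k m))"
        using order_trans by blast
    qed blast
    then obtain f where f: "\<And>j. f j \<le> f (Suc j)" "\<And>j. \<exists>i. e \<le> \<mu> i (H k (f (Suc j)) - H k (f j))"
      by blast
    obtain i where i: "\<And>j. e \<le> \<mu> (i j) (H k (f (Suc j)) - H k (f j))" using f(2) by metis
    have "disjoint_family (\<lambda>j. H k (f (Suc j)) - H k (f j))"
      using lift_Suc_mono_le[of f, OF f(1)] by (intro disjoint_family_increasing_differences H_mono)
    moreover have "H k (f (Suc j)) - H k (f j) \<in> I" for j by (rule ideal_subset[OF H_I]) auto
    ultimately obtain j where "\<mu> (i j) (H k (f (Suc j)) - H k (f j)) < e"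
      using exh \<open>0 < e\<close> unfolding uniformly_exhaustive_def by blast
    then show False using i[of j] by simp
  qed
  have "\<exists>m\<ge>k. \<forall>m'\<ge>m. \<forall>i. \<mu> i (H k m' - H k m) < \<epsilon> / 2 * (1/2) ^ Suc k" for k
    by (rule stable) (use \<open>0 < \<epsilon>\<close> in simp)
  then obtain m where m: "\<And>k. k \<le> m k"
    "\<And>k m' i. m k \<le> m' \<Longrightarrow> \<mu> i (H k m' - H k (m k)) < \<epsilon> / 2 * (1/2) ^ Suc k"
    by metis
  define L where "L k = (\<Inter>j\<in>{..k}. H j (m j))" for k
  have L_antimono: "L j \<subseteq> L i" if "i \<le> j" for i j unfolding L_def using that by (intro INF_superset_mono) auto
  have L_big: "\<epsilon> / 2 \<le> \<mu> (n k) (L k)" for k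
  proof -
    have "E k - L k \<subseteq> (\<Union>j\<in>{..k}. H j (max k (m j)) - H j (m j))"
    proof
      fix x assume x: "x \<in> E k - L k"
      then obtain j where j: "j \<le> k" "x \<notin> H j (m j)" by (auto simp: L_def)
      have "x \<in> H j (max k (m j))" using x j(1) by (auto simp: H_def)
      then show "x \<in> (\<Union>j\<in>{..k}. H j (max k (m j)) - H j (m j))" using j by blast
    qed
    then have "\<mu> (n k) (E k - L k) \<le> \<mu> (n k) (\<Union>j\<in>{..k}. H j (max k (m j)) - H j (m j))"
      by (rule content_mono[OF content])
    also have "\<dots> \<le> (\<Sum>j\<le>k. \<mu> (n k) (H j (max k (m j)) - H j (m j)))"
      by (rule content_UN_le[OF content]) simp
    also have "\<dots> \<le> (\<Sum>j\<le>k. \<epsilon> / 2 * (1/2) ^ Suc j)"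
      by (intro sum_mono less_imp_le[OF m(2)]) simp
    also have "\<dots> = \<epsilon> / 2 * (1 - (1/2) ^ Suc k)"
      by (induction k) (simp_all add: field_simps)
    also have "\<dots> \<le> \<epsilon> / 2" using \<open>0 < \<epsilon>\<close> by simp
    finally have "\<mu> (n k) (E k - L k) \<le> \<epsilon> / 2" .
    moreover have "\<mu> (n k) (E k \<inter> L k) \<le> \<mu> (n k) (L k)" by (rule content_mono[OF content]) simp
    ultimately show ?thesis using big[of k] content_split[OF content, of "n k" "E k" "L k"] by simp
  qed
  have L_small: "\<exists>k'>k. \<mu> (n k) (L k') < \<epsilon> / 4" for k
  proof -
    obtain N where N: "\<And>a b. N \<le> a \<Longrightarrow> norm (\<Sum>j = a..<b. \<mu> (n k) (E j)) < \<epsilon> / 4"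
      using sum[of "n k"] \<open>0 < \<epsilon>\<close> unfolding summable_Cauchy by (meson divide_pos_pos zero_less_numeral)
    define k' where "k' = max N (Suc k)"
    have "\<mu> (n k) (L k') \<le> \<mu> (n k) (\<Union>j\<in>{k'..<Suc (m k')}. E j)"
    proof (rule content_mono[OF content])
      have "L k' \<subseteq> H k' (m k')" by (auto simp: L_def)
      also have "\<dots> \<subseteq> (\<Union>j\<in>{k'..<Suc (m k')}. E j)" unfolding H_def by (intro UN_mono) auto
      finally show "L k' \<subseteq> (\<Union>j\<in>{k'..<Suc (m k')}. E j)" .
    qed
    also have "\<dots> \<le> (\<Sum>j = k'..<Suc (m k'). \<mu> (n k) (E j))" by (rule content_UN_le[OF content]) simp
    also have "\<dots> \<le> norm (\<Sum>j = k'..<Suc (m k'). \<mu> (n k) (E j))" unfolding real_norm_def by (rule abs_ge_self)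
    also have "\<dots> < \<epsilon> / 4" by (rule N) (simp add: k'_def)
    finally show ?thesis by (intro exI[of _ k']) (simp add: k'_def)
  qed
  then obtain f where f: "\<And>k. k < f k" "\<And>k. \<mu> (n k) (L (f k)) < \<epsilon> / 4" by metis
  define g where "g i = (f ^^ i) 0" for i
  have g_Suc: "g (Suc i) = f (g i)" for i by (simp add: g_def)
  have g_mono: "g i \<le> g j" if "i \<le> j" for i j
    by (rule lift_Suc_mono_le[of g, OF _ that]) (simp add: g_Suc f(1) less_imp_le)
  have "disjoint_family (\<lambda>i. L (g i) - L (g (Suc i)))"
    by (intro disjoint_family_decreasing_differences L_antimono g_mono)
  moreover have "L k \<in> I" for k
    by (rule ideal_subset[OF H_I[of 0 "m 0"]]) (auto simp: L_def)
  then have "L (g i) - L (g (Suc i)) \<in> I" for i by (rule ideal_subset) auto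
  ultimately obtain i where "\<mu> (n (g i)) (L (g i) - L (g (Suc i))) < \<epsilon> / 4"
    using exh \<open>0 < \<epsilon>\<close> unfolding uniformly_exhaustive_def
    by (elim allE[of _ "\<lambda>i. L (g i) - L (g (Suc i))"] allE[of _ "\<lambda>i. n (g i)"] allE[of _ "\<epsilon> / 4"]) auto
  moreover have "\<mu> (n (g i)) (L (g i) \<inter> L (g (Suc i))) \<le> \<mu> (n (g i)) (L (f (g i)))"
    by (rule content_mono[OF content]) (simp add: g_Suc)
  ultimately show False
    using L_big[of "g i"] f(2)[of "g i"] content_split[OF content, of "n (g i)" "L (g i)" "L (g (Suc i))"]
    by simp
qed

lemma weak_star_null_subsequence:
  assumes "weak_star_null X F" "filterlim r sequentially sequentially"
  shows "weak_star_null X (\<lambda>k. F (r k))"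
  unfolding weak_star_null_def
proof
  fix x assume "x \<in> X"
  then have "(\<lambda>n. F n x) \<longlonglongrightarrow> 0" using assms(1) by (simp add: weak_star_null_def)
  then show "(\<lambda>k. F (r k) x) \<longlonglongrightarrow> 0" by (rule filterlim_compose) (rule assms(2))
qed

interpretation nwd: c0_ideal nwd
  by standard (rule set_ideal_nwd)

text \<open>
  A single functional has finite variation, so if disjoint sets \<open>A k\<close> carry mass \<open>\<epsilon>\<close> under \<open>F (n k)\<close>,
  the indices \<open>n k\<close> tend to infinity and the \<open>F (n k)\<close> are again weak* null. After thinning, witnesses \<open>x k\<close> of the
  mass on the remaining parts \<open>B k\<close> have a nowhere dense union of supports, hence are the pieces
  of a single \<open>z\<close> in \<open>c0 nwd\<close>, and the gliding hump applies.
\<close>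

lemma nwd_uniformly_exhaustive:
  assumes F: "\<And>n. F n \<in> dual_space (c0 nwd)" and null: "weak_star_null (c0 nwd) F"
  shows "uniformly_exhaustive nwd (\<lambda>n A. nwd.tv (F n) (indicator A))"
proof (rule ccontr)
  assume "\<not> ?thesis"
  then obtain A n \<epsilon> where A: "disjoint_family A" "\<And>k. A k \<in> nwd" and "0 < \<epsilon>"
    and big: "\<And>k :: nat. \<epsilon> \<le> nwd.tv (F (n k)) (indicator (A k))"
    unfolding uniformly_exhaustive_def by (auto simp: not_less)
  obtain C where C: "0 < C" "\<And>n x. x \<in> c0 nwd \<Longrightarrow> \<bar>F n x\<bar> \<le> C * norm x"
    using nwd.weak_star_null_bounded[OF F null] by blast
  have content: "bounded_content (\<lambda>A. nwd.tv (F i) (indicator A)) C" for i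
    by (rule nwd.tv_content[OF F less_imp_le[OF C(1)] C(2)])
  have "finite {k. n k = i}" for i
  proof (rule ccontr)
    assume "infinite {k. n k = i}"
    from infinite_enumerate[OF this] obtain r :: "nat \<Rightarrow> nat"
      where r: "strict_mono r" "\<And>k. n (r k) = i" by auto
    obtain p :: nat where p: "C / \<epsilon> < real p" using reals_Archimedean2 by blast
    have "0 < C / \<epsilon>" using C(1) \<open>0 < \<epsilon>\<close> by simp
    with p have "0 < p" by (cases "p = 0") auto
    have "disjoint_family_on (\<lambda>j. A (r j)) {..<p}"
      using A(1) strict_mono_imp_inj_on[OF r(1)] by (auto simp: disjoint_family_on_def dest: injD)
    then obtain j where j: "nwd.tv (F i) (indicator (A (r j))) \<le> C / real p"
      using content_pigeonhole[OF content _ \<open>0 < p\<close>] by blast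
    moreover have "C / real p < \<epsilon>" using p \<open>0 < p\<close> \<open>0 < \<epsilon>\<close> by (simp add: field_simps)
    ultimately show False using big[of "r j"] r(2)[of j] by simp
  qed
  then have "finite (\<Union>i\<in>{..<Z}. {k. n k = i})" for Z by blast
  then have "finite {k. n k < Z}" for Z
    by (rule finite_subset[rotated]) auto
  then have "eventually (\<lambda>k. Z \<le> n k) sequentially" for Z
    by (simp add: cofinite_eq_sequentially[symmetric] eventually_cofinite not_le)
  then have n_tendsto: "filterlim n sequentially sequentially" by (simp add: filterlim_at_top)
  define G where "G k = F (n k)" for k
  have G: "G k \<in> dual_space (c0 nwd)" for k using F by (simp add: G_def)
  have G_null: "weak_star_null (c0 nwd) G"
    unfolding G_def by (rule weak_star_null_subsequence[OF null n_tendsto])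
  have content_G: "bounded_content (\<lambda>A. nwd.tv (G k) (indicator A)) C" for k
    unfolding G_def by (rule content)
  have "0 < \<epsilon> / 4" using \<open>0 < \<epsilon>\<close> by simp
  obtain r :: "nat \<Rightarrow> nat" and W where r: "strict_mono r" "\<And>k. nwd.tv (G (r k)) (indicator (W k)) \<le> \<epsilon> / 4"
    and thin: "\<And>A. (\<And>k. A k \<in> nwd) \<Longrightarrow> (\<Union>k. A k - W k) \<in> nwd"
    using nwd_thinning[of "\<lambda>k A. nwd.tv (G k) (indicator A)", OF content_G \<open>0 < \<epsilon> / 4\<close>] by blast
  have "\<exists>x. x \<in> c0 nwd \<and> (\<forall>d. \<bar>val x d\<bar> \<le> indicator (A (r k)) d) \<and> \<epsilon> / 2 < G (r k) x" for k
  proof -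
    have "\<epsilon> / 2 < nwd.tv (G (r k)) (indicator (A (r k)))"
      using big[of "r k"] \<open>0 < \<epsilon>\<close> by (simp add: G_def)
    then show ?thesis
      using nwd.tv_witness[of "indicator (A (r k))" "\<epsilon> / 2" "G (r k)"] by (metis indicator_pos_le)
  qed
  then obtain x where x: "\<And>k. x k \<in> c0 nwd" "\<And>k d. \<bar>val (x k) d\<bar> \<le> indicator (A (r k)) d"
    "\<And>k. \<epsilon> / 2 < G (r k) (x k)" by metis
  have x_le_1: "\<bar>val (x k) d\<bar> \<le> 1" for k d
    using order_trans[OF x(2) indicator_le_1] .
  define B where "B k = A (r k) - W k" for k
  have B_disj: "disjoint_family B"
  proof -
    have "B i \<inter> B j = {}" if "i \<noteq> j" for i j
      using disjoint_family_onD[OF A(1), of "r i" "r j"] strict_mono_eq[OF r(1), of i j] that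
      by (auto simp: B_def)
    then show ?thesis by (simp add: disjoint_family_on_def)
  qed
  \<comment> \<open>The \<open>B k\<close> are disjoint, so \<open>sel d\<close> is the only index whose set contains \<open>d\<close>.\<close>
  define sel where "sel d = (SOME k. d \<in> B k)" for d
  have sel: "sel d = k" if "d \<in> B k" for d k
    using someI[of "\<lambda>k. d \<in> B k" k] that B_disj unfolding sel_def disjoint_family_on_def by blast
  define z where "z = bfun (\<lambda>d. indicator (\<Union>k. B k) d * val (x (sel d)) d)"
  have val_z: "val z d = indicator (\<Union>k. B k) d * val (x (sel d)) d" for d
    unfolding z_def by (rule val_bfun[where K = 1]) (use x_le_1 in \<open>simp add: indicator_def\<close>)
  have "(\<Union>k. B k) \<in> nwd" unfolding B_def by (rule thin) (rule A(2))
  then have z: "z \<in> c0 nwd" by (rule nwd.c0_supported) (simp add: val_z)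
  have norm_z: "norm z \<le> 1" by (rule norm_leI) (use x_le_1 in \<open>simp add: val_z indicator_def\<close>)
  have cut_z: "x k = cut (B k) z + cut (W k) (x k)" for k
  proof (rule val_eqI)
    fix d
    show "val (x k) d = val (cut (B k) z + cut (W k) (x k)) d"
    proof (cases "d \<in> A (r k)")
      case True
      then show ?thesis using sel[of d k] by (auto simp: val_z indicator_def B_def)
    next
      case False
      then show ?thesis using x(2)[of k d] by (simp add: B_def)
    qed
  qed
  have "\<epsilon> / 4 \<le> \<bar>G (r k) (cut (B k) z)\<bar>" for k
  proof -
    have "G (r k) (x k) = G (r k) (cut (B k) z) + G (r k) (cut (W k) (x k))"
      using nwd.dual_add[OF G nwd.c0_cut[OF z] nwd.c0_cut[OF x(1)]] cut_z by metis
    moreover have "\<bar>G (r k) (cut (W k) (x k))\<bar> \<le> \<epsilon> / 4"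
      by (rule order_trans[OF nwd.abs_cut_le[OF G x(1) norm_leI] r(2)]) (rule x_le_1)
    ultimately show ?thesis using x(3)[of k] by linarith
  qed
  moreover have "weak_star_null (c0 nwd) (\<lambda>k. G (r k))"
    by (rule weak_star_null_subsequence[OF G_null filterlim_subseq[OF r(1)]])
  then have "\<exists>k. \<bar>G (r k) (cut (B k) z)\<bar> < \<epsilon> / 4"
    using \<open>0 < \<epsilon>\<close> by (intro nwd.phillips_disjoint[OF G _ z norm_z B_disj]) auto
  ultimately show False by (simp add: not_less[symmetric])
qed

section \<open>A control functional\<close>

context c0_ideal
begin

context
  fixes F :: "nat \<Rightarrow> 'd l_infty \<Rightarrow> real" and C :: real
  assumes F: "\<And>n. F n \<in> dual"
    and C: "0 < C" "\<And>n x. x \<in> c0 I \<Longrightarrow> \<bar>F n x\<bar> \<le> C * norm x"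
begin

text \<open>
  The integral against the control measure of the sequence: positive, additive, and
  dominating every \<open>|F n|\<close> up to a factor.
\<close>

definition control :: "('d \<Rightarrow> real) \<Rightarrow> real" where
  "control g = (\<Sum>n. (1/2) ^ n * tv (F n) g)"

lemma control_summable:
  assumes "\<And>d. 0 \<le> g d" "\<And>d. g d \<le> B"
  shows "summable (\<lambda>n. (1/2) ^ n * tv (F n) g)"
proof (rule summable_comparison_test')
  show "summable (\<lambda>n. (1/2) ^ n * (C * B))" by (intro summable_mult2 summable_geometric) simp
  show "norm ((1/2) ^ n * tv (F n) g) \<le> (1/2) ^ n * (C * B)" for n
    using tv_nonneg[OF F assms] tv_le_bound[OF C(2) less_imp_le[OF C(1)] assms] by simp
qed

lemma control_add:
  assumes "\<And>d. 0 \<le> g d" "\<And>d. g d \<le> B" "\<And>d. 0 \<le> h d" "\<And>d. h d \<le> B'"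
  shows "control (\<lambda>d. g d + h d) = control g + control h"
  unfolding control_def tv_add[OF F assms] distrib_left
  by (rule suminf_add[symmetric]) (rule control_summable assms)+

lemma control_scale:
  assumes "\<And>d. 0 \<le> g d" "\<And>d. g d \<le> B" "0 < c"
  shows "control (\<lambda>d. c * g d) = c * control g"
  unfolding control_def tv_scale[OF F assms] mult.left_commute[of _ c]
  by (rule suminf_mult) (rule control_summable assms)+

lemma control_nonneg:
  assumes "\<And>d. 0 \<le> g d" "\<And>d. g d \<le> B"
  shows "0 \<le> control g"
  unfolding control_def
  by (intro suminf_nonneg control_summable[OF assms]) (simp add: tv_nonneg[OF F assms])

lemma control_le:
  assumes "\<And>d. 0 \<le> g d" "\<And>d. g d \<le> 1"
  shows "control g \<le> 2 * C"
proof -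
  have "control g \<le> (\<Sum>n. (1/2) ^ n * C)"
    unfolding control_def
    using tv_le_bound[OF C(2) less_imp_le[OF C(1)] assms]
    by (intro suminf_le control_summable[OF assms] summable_mult2 summable_geometric) auto
  also have "\<dots> = 2 * C" using suminf_geometric[of "1/2 :: real"] by (simp add: suminf_mult2[symmetric])
  finally show ?thesis .
qed

lemma tv_le_control:
  assumes "\<And>d. 0 \<le> g d" "\<And>d. g d \<le> B"
  shows "tv (F i) g \<le> 2 ^ i * control g"
proof -
  have "(\<Sum>n\<in>{i}. (1/2) ^ n * tv (F n) g) \<le> control g"
    unfolding control_def
    by (intro sum_le_suminf control_summable[OF assms]) (simp_all add: tv_nonneg[OF F assms])
  then show ?thesis by (simp add: power_divide field_simps)
qed

definition energy :: "'d l_infty \<Rightarrow> real" where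
  "energy x = control (\<lambda>d. (val x d)\<^sup>2)"

lemma square_val_le: "(val x d)\<^sup>2 \<le> (norm x)\<^sup>2"
  by (metis abs_val_le_norm abs_ge_zero power_mono power2_abs)

lemma energy_nonneg: "0 \<le> energy x"
  unfolding energy_def by (rule control_nonneg[OF zero_le_power2 square_val_le])

lemma energy_le: "norm x \<le> 1 \<Longrightarrow> energy x \<le> 2 * C"
  unfolding energy_def
  by (rule control_le[OF zero_le_power2]) (meson square_val_le norm_ge_zero order_trans power_le_one)

text \<open>
  The identity holds pointwise for squares of real numbers, and the control functional is linear on
  nonnegative functions. It is all that is needed of a Hilbert space.
\<close>

lemma energy_parallelogram:
  "energy (x - y) + 4 * energy ((1/2) *\<^sub>R (x + y)) = 2 * energy x + 2 * energy y"
proof -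
  have bounds: "0 \<le> a * (val u d)\<^sup>2" "a * (val u d)\<^sup>2 \<le> a * (norm u)\<^sup>2" if "0 < a" for a u d
    using that square_val_le[of u d] by (simp_all add: mult_left_mono)
  have scale: "control (\<lambda>d. a * (val u d)\<^sup>2) = a * energy u" if "0 < a" for a u
    unfolding energy_def by (rule control_scale[OF zero_le_power2 square_val_le that])
  have "control (\<lambda>d. (val (x - y) d)\<^sup>2 + 4 * (val ((1/2) *\<^sub>R (x + y)) d)\<^sup>2)
      = energy (x - y) + control (\<lambda>d. 4 * (val ((1/2) *\<^sub>R (x + y)) d)\<^sup>2)"
    unfolding energy_def by (rule control_add[OF zero_le_power2 square_val_le bounds]) simp_all
  moreover have "control (\<lambda>d. 2 * (val x d)\<^sup>2 + 2 * (val y d)\<^sup>2)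
      = control (\<lambda>d. 2 * (val x d)\<^sup>2) + control (\<lambda>d. 2 * (val y d)\<^sup>2)"
    by (rule control_add[OF bounds bounds]) simp_all
  moreover have "(\<lambda>d. (val (x - y) d)\<^sup>2 + 4 * (val ((1/2) *\<^sub>R (x + y)) d)\<^sup>2) =
      (\<lambda>d. 2 * (val x d)\<^sup>2 + 2 * (val y d)\<^sup>2)"
    by (rule ext) (simp add: power2_eq_square field_simps)
  ultimately show ?thesis by (simp only: scale zero_less_numeral)
qed

text \<open>
  By Markov's inequality a \<open>z\<close> of small energy exceeds the threshold \<open>\<theta>\<close> only on a set that is small
  for each variation, hence small for all of them uniformly. Off that set \<open>|F n|\<close> sees at most \<open>\<theta> C\<close>,
  which is \<open>c / 2\<close>, and on it at most twice the variation of the set.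
\<close>

lemma energy_controls:
  assumes exh: "uniformly_exhaustive I (\<lambda>n A. tv (F n) (indicator A))" and "0 < c"
  obtains \<eta> where "0 < \<eta>"
    "\<And>n z. z \<in> c0 I \<Longrightarrow> norm z \<le> 2 \<Longrightarrow> energy z < \<eta> \<Longrightarrow> F n z < c"
proof (rule ccontr)
  assume "\<not> thesis"
  with that have "\<exists>n z. z \<in> c0 I \<and> norm z \<le> 2 \<and> energy z < \<eta> \<and> c \<le> F n z" if "0 < \<eta>" for \<eta>
    using \<open>0 < \<eta>\<close> by (meson not_le)
  then have "\<exists>n z. z \<in> c0 I \<and> norm z \<le> 2 \<and> energy z < (1/2) ^ k \<and> c \<le> F n z" for k by simp
  then obtain n z where z: "\<And>k. z k \<in> c0 I" "\<And>k. norm (z k) \<le> 2" "\<And>k. energy (z k) < (1/2) ^ k"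
    and big: "\<And>k. c \<le> F (n k) (z k)" by metis
  define \<theta> where "\<theta> = c / (2 * C)"
  have \<theta>: "0 < \<theta>" "\<theta> * C = c / 2" using \<open>0 < c\<close> C(1) by (simp_all add: \<theta>_def)
  define E where "E k = {d. \<theta> \<le> \<bar>val (z k) d\<bar>}" for k
  have E: "E k \<in> I" for k unfolding E_def by (rule c0_large[OF z(1) \<theta>(1)])
  have content: "bounded_content (\<lambda>A. tv (F i) (indicator A)) C" for i
    by (rule tv_content[OF F less_imp_le[OF C(1)] C(2)])
  have small: "tv (F i) (indicator (E k)) \<le> (1/2) ^ k * (2 ^ i / \<theta>\<^sup>2)" for i k
  proof -
    have "tv (F i) (indicator (E k)) \<le> tv (F i) (\<lambda>d. 1 / \<theta>\<^sup>2 * (val (z k) d)\<^sup>2)"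
    proof (rule tv_mono[OF F])
      show "indicator (E k) d \<le> 1 / \<theta>\<^sup>2 * (val (z k) d)\<^sup>2" for d
        using \<theta>(1) power_mono[of \<theta> "\<bar>val (z k) d\<bar>" 2] by (simp add: indicator_def E_def field_simps)
      show "1 / \<theta>\<^sup>2 * (val (z k) d)\<^sup>2 \<le> 1 / \<theta>\<^sup>2 * (norm (z k))\<^sup>2" for d
        by (intro mult_left_mono square_val_le) simp
    qed simp
    also have "\<dots> = 1 / \<theta>\<^sup>2 * tv (F i) (\<lambda>d. (val (z k) d)\<^sup>2)"
      by (rule tv_scale[OF F zero_le_power2 square_val_le]) (use \<theta>(1) in simp)
    also have "\<dots> \<le> 1 / \<theta>\<^sup>2 * (2 ^ i * energy (z k))"
      unfolding energy_def by (intro mult_left_mono tv_le_control[OF zero_le_power2 square_val_le]) simp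
    also have "\<dots> \<le> 1 / \<theta>\<^sup>2 * (2 ^ i * (1/2) ^ k)"
      by (intro mult_left_mono less_imp_le[OF z(3)]) simp_all
    finally show ?thesis by (simp add: mult.commute)
  qed
  have "summable (\<lambda>k. tv (F i) (indicator (E k)))" for i
  proof (rule summable_comparison_test')
    show "summable (\<lambda>k. (1/2) ^ k * (2 ^ i / \<theta>\<^sup>2))" by (intro summable_mult2 summable_geometric) simp
    show "norm (tv (F i) (indicator (E k))) \<le> (1/2) ^ k * (2 ^ i / \<theta>\<^sup>2)" for k
      using small[of i k] content_nonneg[OF content, of i "E k"] by simp
  qed
  then obtain k where k: "tv (F (n k)) (indicator (E k)) < c / 4"
    using uniformly_exhaustive_imp_uniformly_small[where E = E and n = n and \<epsilon> = "c / 4", OF ideal content exh E] \<open>0 < c\<close> by auto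
  have "F (n k) (z k) \<le> tv (F (n k)) (\<lambda>d. \<theta> * 1 + 2 * indicator (E k) d)"
  proof (rule tv_upper[OF F _ z(1), where B = "\<theta> + 2"])
    show "\<bar>val (z k) d\<bar> \<le> \<theta> * 1 + 2 * indicator (E k) d" for d
      using abs_val_le_norm[of "z k" d] z(2)[of k] \<theta>(1) by (auto simp: indicator_def E_def)
  qed (simp add: indicator_def)
  also have "\<dots> = tv (F (n k)) (\<lambda>d. \<theta> * 1) + tv (F (n k)) (\<lambda>d. 2 * indicator (E k) d)"
    by (rule tv_add[OF F, where B = \<theta> and B' = 2]) (use \<theta>(1) in \<open>auto simp: indicator_def\<close>)
  also have "tv (F (n k)) (\<lambda>d. 2 * indicator (E k) d) = 2 * tv (F (n k)) (indicator (E k))"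
    by (rule tv_scale[OF F, where B = 1]) (auto simp: indicator_def)
  also have "tv (F (n k)) (\<lambda>d. \<theta> * 1) \<le> C * \<theta>"
    by (rule tv_le_bound[OF C(2) less_imp_le[OF C(1)]]) (use \<theta>(1) in auto)
  finally show False using big[of k] k \<theta>(2) by (simp add: mult.commute)
qed

end

end

section \<open>Separation\<close>

text \<open>
  Helly's theorem for finitely many affine functions. In the induction step the functions other than \<open>f a\<close>
  are treated on the convex set where \<open>c \<le> f a\<close>; if that yields a combination \<open>G\<close> that is at most \<open>c\<close>
  there, the planar image of \<open>B\<close> under \<open>(G, f a)\<close> misses the quadrant \<open>{c<..} \<times> {c..}\<close>, and a line that
  separates them has a normal vector with nonnegative entries \<open>p\<close> and \<open>q\<close>, which gives the weights.
\<close>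

lemma convex_finite_alternative:
  fixes f :: "'i \<Rightarrow> 'v::real_vector \<Rightarrow> real"
  assumes "finite S" "S \<noteq> {}" "convex B"
    and affine: "\<And>i x y u v. i \<in> S \<Longrightarrow> x \<in> B \<Longrightarrow> y \<in> B \<Longrightarrow> 0 \<le> u \<Longrightarrow> 0 \<le> v \<Longrightarrow> u + v = 1 \<Longrightarrow>
      f i (u *\<^sub>R x + v *\<^sub>R y) = u * f i x + v * f i y"
  shows "(\<exists>x\<in>B. \<forall>i\<in>S. c \<le> f i x) \<or>
    (\<exists>w. (\<forall>i\<in>S. 0 \<le> w i) \<and> sum w S = 1 \<and> (\<forall>x\<in>B. (\<Sum>i\<in>S. w i * f i x) \<le> c))"
  using assms
proof (induction S arbitrary: B rule: finite_ne_induct)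
  case (singleton a)
  have "\<exists>w. (\<forall>i\<in>{a}. 0 \<le> w i) \<and> sum w {a} = 1 \<and> (\<forall>x\<in>B. (\<Sum>i\<in>{a}. w i * f i x) \<le> c)"
    if "\<not> (\<exists>x\<in>B. \<forall>i\<in>{a}. c \<le> f i x)"
    using that by (intro exI[of _ "\<lambda>_. 1"]) (auto simp: not_le intro: less_imp_le)
  then show ?case by blast
next
  case (insert a S)
  define B' where "B' = {x \<in> B. c \<le> f a x}"
  have "convex B'"
    unfolding convex_def B'_def
  proof (intro ballI allI impI CollectI conjI; elim CollectE conjE)
    fix x y and u v :: real
    assume *: "x \<in> B" "y \<in> B" "c \<le> f a x" "c \<le> f a y" "0 \<le> u" "0 \<le> v" "u + v = 1"
    then show "u *\<^sub>R x + v *\<^sub>R y \<in> B" using insert.prems(1) by (auto simp: convex_def)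
    have "u * c + v * c \<le> u * f a x + v * f a y" using * by (intro add_mono mult_left_mono) auto
    moreover have "u * c + v * c = c" using * by (metis distrib_right mult_1)
    ultimately show "c \<le> f a (u *\<^sub>R x + v *\<^sub>R y)" using insert.prems(2)[of a x y u v] * by simp
  qed
  then consider (point) x where "x \<in> B'" "\<forall>i\<in>S. c \<le> f i x"
    | (weights) w where "\<forall>i\<in>S. 0 \<le> w i" "sum w S = 1" "\<forall>x\<in>B'. (\<Sum>i\<in>S. w i * f i x) \<le> c"
    using insert.IH[of B'] insert.prems(2) unfolding B'_def by auto
  then show ?case
  proof cases
    case point
    then show ?thesis unfolding B'_def by auto
  next
    case weights
    define G where "G x = (\<Sum>i\<in>S. w i * f i x)" for x
    show ?thesis
    proof (cases "B = {}")
      case True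
      have "sum (\<lambda>i. if i = a then 1 else 0 :: real) (insert a S) = 1" using insert.hyps by simp
      then show ?thesis using True by (intro disjI2 exI[of _ "\<lambda>i. if i = a then 1 else 0"]) auto
    next
      case False
      let ?X = "(\<lambda>x. (G x, f a x)) ` B" and ?T = "{c<..} \<times> {c..}"
      have G_affine: "G (u *\<^sub>R x + v *\<^sub>R y) = u * G x + v * G y"
        if "x \<in> B" "y \<in> B" "0 \<le> u" "0 \<le> v" "u + v = 1" for x y u v
        using insert.prems(2)[OF _ that]
        by (simp add: G_def sum_distrib_left sum.distrib[symmetric] algebra_simps cong: sum.cong)
      have "convex ?X"
        unfolding convex_def
      proof (intro ballI allI impI; elim imageE; clarify)
        fix x y and u v :: real
        assume *: "x \<in> B" "y \<in> B" "0 \<le> u" "0 \<le> v" "u + v = 1"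
        then have "u *\<^sub>R x + v *\<^sub>R y \<in> B" using insert.prems(1) by (auto simp: convex_def)
        then show "u *\<^sub>R (G x, f a x) + v *\<^sub>R (G y, f a y) \<in> ?X"
          using G_affine[OF *] insert.prems(2)[OF _ *, of a] by (auto intro!: image_eqI)
      qed
      moreover have "convex ?T" by (intro convex_Times) auto
      moreover have "?X \<inter> ?T = {}" using weights(3) by (auto simp: B'_def G_def)
      moreover have "(c + 1, c) \<in> ?T" by simp
      ultimately obtain pq b where sep: "pq \<noteq> 0" "\<forall>x\<in>?X. inner pq x \<le> b" "\<forall>x\<in>?T. b \<le> inner pq x"
        using separating_hyperplane_sets[of ?X ?T] False by blast
      obtain p q where pq: "pq = (p, q)" by (cases pq)
      have X: "p * G x + q * f a x \<le> b" if "x \<in> B" for x using sep(2) that by (auto simp: pq)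
      have T: "b \<le> p * u + q * v" if "c < u" "c \<le> v" for u v using sep(3) that by (auto simp: pq)
      have "0 \<le> p"
      proof (rule ccontr)
        assume "\<not> 0 \<le> p"
        define t where "t = (\<bar>b - p * (c + 1) - q * c\<bar> + 1) / (- p)"
        have "0 \<le> t" "p * t = - (\<bar>b - p * (c + 1) - q * c\<bar> + 1)"
          using \<open>\<not> 0 \<le> p\<close> by (auto simp: t_def zero_le_divide_iff divide_le_0_iff)
        then show False using T[of "c + 1 + t" c] by (simp add: algebra_simps)
      qed
      moreover have "0 \<le> q"
      proof (rule ccontr)
        assume "\<not> 0 \<le> q"
        define t where "t = (\<bar>b - p * (c + 1) - q * c\<bar> + 1) / (- q)"
        have "0 \<le> t" "q * t = - (\<bar>b - p * (c + 1) - q * c\<bar> + 1)"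
          using \<open>\<not> 0 \<le> q\<close> by (auto simp: t_def zero_le_divide_iff divide_le_0_iff)
        then show False using T[of "c + 1" "c + t"] by (simp add: algebra_simps)
      qed
      moreover have "p \<noteq> 0 \<or> q \<noteq> 0" using sep(1) by (auto simp: pq zero_prod_def)
      ultimately have s: "0 < p + q" by auto
      have "b \<le> (p + q) * c"
      proof (rule field_le_epsilon)
        fix e :: real assume "0 < e"
        have "b \<le> p * (c + e / (p + q)) + q * c" using \<open>0 < e\<close> s by (intro T) auto
        also have "\<dots> = (p + q) * c + p / (p + q) * e" by (simp add: algebra_simps)
        also have "p / (p + q) * e \<le> 1 * e"
          using \<open>0 < e\<close> s \<open>0 \<le> q\<close> by (intro mult_right_mono) (auto simp: divide_le_eq)
        finally show "b \<le> (p + q) * c + e" by simp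
      qed
      define w' where "w' i = (if i = a then q else p * w i) / (p + q)" for i
      have w': "(\<Sum>i\<in>insert a S. w' i * h i) = (q * h a + p * (\<Sum>i\<in>S. w i * h i)) / (p + q)" for h
      proof -
        have "(\<Sum>i\<in>S. w' i * h i) = (\<Sum>i\<in>S. p * (w i * h i) / (p + q))"
          using insert.hyps by (intro sum.cong) (auto simp: w'_def)
        also have "\<dots> = p * (\<Sum>i\<in>S. w i * h i) / (p + q)"
          by (simp add: sum_distrib_left sum_divide_distrib)
        finally show ?thesis using insert.hyps by (simp add: w'_def add_divide_distrib)
      qed
      have "sum w' (insert a S) = 1" using w'[of "\<lambda>_. 1"] weights(2) s by (simp add: add.commute)
      moreover have "(\<Sum>i\<in>insert a S. w' i * f i x) \<le> c" if "x \<in> B" for x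
        unfolding w' using X[OF that] \<open>b \<le> (p + q) * c\<close> s by (simp add: G_def divide_le_eq mult.commute add.commute)
      moreover have "\<forall>i\<in>insert a S. 0 \<le> w' i"
        using weights(1) \<open>0 \<le> p\<close> \<open>0 \<le> q\<close> by (auto simp: w'_def)
      ultimately show ?thesis by blast
    qed
  qed
qed

section \<open>Weak convergence\<close>

context c0_ideal
begin

lemma dual_space_scale:
  assumes "F \<in> dual"
  shows "(\<lambda>x. c * F x) \<in> dual"
proof -
  obtain K where K: "\<And>x. x \<in> c0 I \<Longrightarrow> \<bar>F x\<bar> \<le> K * norm x" using dual_bounded[OF assms] by blast
  have "\<bar>c * F x\<bar> \<le> (\<bar>c\<bar> * K) * norm x" if "x \<in> c0 I" for x
    using mult_left_mono[OF K[OF that], of "\<bar>c\<bar>"] by (simp add: abs_mult mult.assoc)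
  then have "\<exists>K. \<forall>x\<in>c0 I. \<bar>c * F x\<bar> \<le> K * norm x" by blast
  then show ?thesis using assms unfolding dual_space_def by (simp add: algebra_simps)
qed

lemma dual_space_add:
  assumes "F \<in> dual" "G \<in> dual"
  shows "(\<lambda>x. F x + G x) \<in> dual"
proof -
  obtain K L where K: "\<And>x. x \<in> c0 I \<Longrightarrow> \<bar>F x\<bar> \<le> K * norm x" and L: "\<And>x. x \<in> c0 I \<Longrightarrow> \<bar>G x\<bar> \<le> L * norm x"
    using dual_bounded[OF assms(1)] dual_bounded[OF assms(2)] by metis
  have "\<bar>F x + G x\<bar> \<le> (K + L) * norm x" if "x \<in> c0 I" for x
    using K[OF that] L[OF that] by (simp add: distrib_right)
  then have "\<exists>K. \<forall>x\<in>c0 I. \<bar>F x + G x\<bar> \<le> K * norm x" by blast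
  then show ?thesis using assms unfolding dual_space_def by (simp add: algebra_simps)
qed

lemma bidual_add:
    "\<phi> \<in> bidual_space (c0 I) \<Longrightarrow> f \<in> dual \<Longrightarrow> g \<in> dual \<Longrightarrow> \<phi> (\<lambda>x. f x + g x) = \<phi> f + \<phi> g"
  and bidual_scale:
    "\<phi> \<in> bidual_space (c0 I) \<Longrightarrow> f \<in> dual \<Longrightarrow> \<phi> (\<lambda>x. c * f x) = c * \<phi> f"
  by (simp_all add: bidual_space_def)

lemma bidual_linear_combination:
  assumes "\<phi> \<in> bidual_space (c0 I)" "finite S" "\<And>i. i \<in> S \<Longrightarrow> F i \<in> dual"
  shows "(\<lambda>x. \<Sum>i\<in>S. w i * F i x) \<in> dual \<and> \<phi> (\<lambda>x. \<Sum>i\<in>S. w i * F i x) = (\<Sum>i\<in>S. w i * \<phi> (F i))"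
  using assms(2,3)
proof induction
  case empty
  have "(\<lambda>x. 0) \<in> dual" by (auto simp: dual_space_def intro: exI[of _ 0])
  moreover from bidual_scale[OF assms(1) this, of 0] have "\<phi> (\<lambda>x. 0) = 0" by simp
  ultimately show ?case by simp
next
  case (insert a S)
  let ?G = "\<lambda>x. w a * F a x" and ?H = "\<lambda>x. \<Sum>i\<in>S. w i * F i x"
  have mem: "?G \<in> dual" "?H \<in> dual" using insert by (auto intro: dual_space_scale)
  then have "\<phi> (\<lambda>x. ?G x + ?H x) = \<phi> ?G + \<phi> ?H"
    by (rule bidual_add[OF assms(1)])
  moreover have "\<phi> ?G = w a * \<phi> (F a)"
    by (rule bidual_scale[OF assms(1) insert.prems]) simp
  ultimately show ?case using insert dual_space_add[OF mem] by simp
qed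

text \<open>
  The values \<open>F n (x N)\<close> are at least \<open>c\<close> for \<open>n \<le> N\<close>, but tend to \<open>0\<close> in \<open>n\<close> for fixed \<open>N\<close>. This is
  contradictory as soon as the \<open>x N\<close> can be compared with one another uniformly in \<open>n\<close>. Passing to
  convex combinations of tails keeps the lower bounds and makes the comparison possible, because
  almost minimal energy forces closeness.
\<close>

lemma no_uniform_bidual_bound:
  assumes F: "\<And>n. F n \<in> dual" and null: "weak_star_null (c0 I) F"
    and exh: "uniformly_exhaustive I (\<lambda>n A. tv (F n) (indicator A))"
    and \<phi>: "\<phi> \<in> bidual_space (c0 I)" and "0 < \<delta>"
  shows "\<exists>n. \<phi> (F n) < \<delta>"
proof (rule ccontr)
  assume "\<not> ?thesis"
  then have \<phi>_big: "\<delta> \<le> \<phi> (F n)" for n by (simp add: not_less)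
  obtain C where C: "0 < C" "\<And>n x. x \<in> c0 I \<Longrightarrow> \<bar>F n x\<bar> \<le> C * norm x"
    using weak_star_null_bounded[OF F null] by blast
  obtain K where K: "\<And>f. f \<in> dual \<Longrightarrow> \<bar>\<phi> f\<bar> \<le> K * dual_norm (c0 I) f"
    using \<phi> unfolding bidual_space_def by blast
  define c where "c = \<delta> / (2 * max 1 K)"
  have c: "0 < c" "max 1 K * c < \<delta>" using \<open>0 < \<delta>\<close> by (auto simp: c_def field_simps)
  let ?B = "{x \<in> c0 I. norm x \<le> 1}"
  have "convex (c0 I)" using subspace_c0 by (rule subspace_imp_convex)
  moreover have "?B = c0 I \<inter> cball 0 1" by auto
  ultimately have "convex ?B" by (simp add: convex_Int)
  have F_affine: "F n (u *\<^sub>R x + v *\<^sub>R y) = u * F n x + v * F n y" if "x \<in> c0 I" "y \<in> c0 I" for n u v x y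
    using that by (simp add: dual_add dual_scaleR F c0_scaleR)
  \<comment> \<open>Otherwise some convex combination \<open>G\<close> of \<open>F 0, ..., F N\<close> would have norm at most \<open>c\<close>, although \<open>\<phi> G\<close> is at least \<open>\<delta>\<close>.\<close>
  have "\<exists>x\<in>?B. \<forall>n\<in>{..N}. c \<le> F n x" for N
  proof (rule ccontr)
    assume none: "\<not> ?thesis"
    have "(\<exists>x\<in>?B. \<forall>n\<in>{..N}. c \<le> F n x) \<or> (\<exists>w. (\<forall>n\<in>{..N}. 0 \<le> w n) \<and> sum w {..N} = 1 \<and>
        (\<forall>x\<in>?B. (\<Sum>n\<in>{..N}. w n * F n x) \<le> c))"
      by (rule convex_finite_alternative) (use \<open>convex ?B\<close> F_affine in auto)
    then obtain w where w: "\<And>n. n \<le> N \<Longrightarrow> 0 \<le> w n" "sum w {..N} = 1"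
      "\<And>x. x \<in> ?B \<Longrightarrow> (\<Sum>n\<in>{..N}. w n * F n x) \<le> c" using none by auto
    define G where "G x = (\<Sum>n\<in>{..N}. w n * F n x)" for x
    have G: "G \<in> dual" "\<phi> G = (\<Sum>n\<in>{..N}. w n * \<phi> (F n))"
      using bidual_linear_combination[where S = "{..N}" and w = w and F = F, OF \<phi> finite_atMost F] unfolding G_def by auto
    have "dual_norm (c0 I) G \<le> c"
      unfolding dual_norm_def
    proof (rule cSUP_least)
      show "?B \<noteq> {}" using c0_zero by auto
      fix x assume x: "x \<in> ?B"
      then have "- x \<in> ?B" using c0_scaleR[of x "-1"] by simp
      then show "\<bar>G x\<bar> \<le> c"
        using w(3)[OF x] w(3)[of "- x"] dual_minus[OF G(1), of x] x by (simp add: G_def[symmetric] abs_le_iff)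
    qed
    have "0 \<le> dual_norm (c0 I) G"
    proof -
      obtain L where L: "0 < L" "\<And>x. x \<in> c0 I \<Longrightarrow> \<bar>G x\<bar> \<le> L * norm x" using dual_bounded[OF G(1)] by blast
      have "\<bar>G 0\<bar> \<le> dual_norm (c0 I) G"
        unfolding dual_norm_def
      proof (rule cSUP_upper)
        show "bdd_above ((\<lambda>x. \<bar>G x\<bar>) ` ?B)"
          by (rule bdd_aboveI2[of _ _ L]) (use L mult_left_le in \<open>fastforce intro: order_trans\<close>)
      qed (simp add: c0_zero)
      then show ?thesis by simp
    qed
    have "\<delta> = (\<Sum>n\<in>{..N}. w n * \<delta>)" using w(2) by (simp add: sum_distrib_right[symmetric])
    also have "\<dots> \<le> \<phi> G" unfolding G(2) using w(1) \<phi>_big by (intro sum_mono mult_left_mono) auto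
    also have "\<dots> \<le> K * dual_norm (c0 I) G" using K[OF G(1)] by simp
    also have "\<dots> \<le> max 1 K * c"
      using \<open>dual_norm (c0 I) G \<le> c\<close> \<open>0 \<le> dual_norm (c0 I) G\<close> by (intro mult_mono) auto
    finally show False using c(2) by simp
  qed
  then have "\<exists>x. x \<in> c0 I \<and> norm x \<le> 1 \<and> (\<forall>n\<le>N. c \<le> F n x)" for N by blast
  then obtain x where x: "\<And>N. x N \<in> c0 I" "\<And>N. norm (x N) \<le> 1" "\<And>N n. n \<le> N \<Longrightarrow> c \<le> F n (x N)"
    by metis
  define tail where "tail N = convex hull (x ` {N..})" for N
  have tail: "y \<in> c0 I" "norm y \<le> 1" "\<And>n. n \<le> N \<Longrightarrow> c \<le> F n y" if "y \<in> tail N" for y N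
  proof -
    have "convex {y \<in> ?B. \<forall>n\<le>N. c \<le> F n y}"
      unfolding convex_def
    proof (intro ballI allI impI CollectI conjI)
      fix y z and u v :: real and n
      assume *: "y \<in> {y \<in> ?B. \<forall>n\<le>N. c \<le> F n y}" "z \<in> {y \<in> ?B. \<forall>n\<le>N. c \<le> F n y}"
        "0 \<le> u" "0 \<le> v" "u + v = 1"
      show "u *\<^sub>R y + v *\<^sub>R z \<in> c0 I" "norm (u *\<^sub>R y + v *\<^sub>R z) \<le> 1"
        using \<open>convex ?B\<close> * unfolding convex_def by blast+
      assume "n \<le> N"
      then have "u * c + v * c \<le> u * F n y + v * F n z" using * by (intro add_mono mult_left_mono) auto
      moreover have "u * c + v * c = c" using * by (metis distrib_right mult_1)
      ultimately show "c \<le> F n (u *\<^sub>R y + v *\<^sub>R z)" using F_affine * by simp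
    qed
    then have "tail N \<subseteq> {y \<in> ?B. \<forall>n\<le>N. c \<le> F n y}"
      unfolding tail_def using x by (intro hull_minimal) auto
    then show "y \<in> c0 I" "norm y \<le> 1" "\<And>n. n \<le> N \<Longrightarrow> c \<le> F n y" using that by auto
  qed
  have tail_antimono: "tail M \<subseteq> tail N" if "N \<le> M" for M N
    unfolding tail_def using that by (intro hull_mono image_mono) auto
  have tail_ne: "tail N \<noteq> {}" for N by (simp add: tail_def)
  let ?E = "energy F"
  have "0 < c / 2" using c(1) by simp
  then obtain \<eta> where \<eta>: "0 < \<eta>"
    "\<And>n z. z \<in> c0 I \<Longrightarrow> norm z \<le> 2 \<Longrightarrow> ?E z < \<eta> \<Longrightarrow> F n z < c / 2"
    using energy_controls[OF F C exh] by blast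
  define e where "e N = Inf (?E ` tail N)" for N
  have bdd: "bdd_below (?E ` tail N)" for N
    by (rule bdd_belowI2[of _ 0]) (rule energy_nonneg[OF F C])
  have e_le: "e N \<le> ?E y" if "y \<in> tail N" for y N
    unfolding e_def using bdd that by (rule cINF_lower)
  have e_near: "\<exists>y\<in>tail N. ?E y < e N + \<eta> / 8" for N
    using cINF_less_iff[OF tail_ne bdd, of N "e N + \<eta> / 8"] \<eta>(1) by (simp add: e_def)
  have e_mono: "e N \<le> e M" if "N \<le> M" for M N
    unfolding e_def using that by (intro cINF_superset_mono tail_ne bdd tail_antimono) auto
  have e_bdd: "bdd_above (range e)"
  proof (rule bdd_aboveI2)
    fix N
    obtain y where y: "y \<in> tail N" using tail_ne by blast
    show "e N \<le> 2 * C" by (rule order_trans[OF e_le[OF y] energy_le[OF F C tail(2)[OF y]]])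
  qed
  \<comment> \<open>The minimal energies of the tails increase to a finite limit, so beyond some \<open>m\<close> they vary by less than \<open>\<eta> / 8\<close>.\<close>
  have "Sup (range e) - \<eta> / 8 < Sup (range e)" using \<eta>(1) by simp
  then obtain m where "Sup (range e) - \<eta> / 8 < e m" using less_cSupE by blast
  then have m: "e M - \<eta> / 8 < e m" for M using cSUP_upper[OF UNIV_I e_bdd, of M] by linarith
  obtain y where y: "y \<in> tail m" "?E y < e m + \<eta> / 8" using e_near by blast
  have "(\<lambda>n. F n y) \<longlonglongrightarrow> 0" using null tail(1)[OF y(1)] by (simp add: weak_star_null_def)
  then have "eventually (\<lambda>n. F n y < c / 2) sequentially" by (rule order_tendstoD) (use c(1) in simp)
  then obtain n where n: "F n y < c / 2" by (meson eventually_happens sequentially_bot)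
  obtain y' where y': "y' \<in> tail (max m n)" "?E y' < e (max m n) + \<eta> / 8" using e_near by blast
  have "y' \<in> tail m" using y'(1) tail_antimono[of m "max m n"] by auto
  have "(1/2) *\<^sub>R (y' + y) \<in> tail m"
    using convexD[OF convex_convex_hull \<open>y' \<in> tail m\<close>[unfolded tail_def] y(1)[unfolded tail_def], of "1/2" "1/2"]
    by (simp add: tail_def scaleR_add_right)
  note mid = e_le[OF this]
  have "?E (y' - y) + 4 * ?E ((1/2) *\<^sub>R (y' + y)) = 2 * ?E y' + 2 * ?E y"
    by (rule energy_parallelogram[OF F C])
  then have "?E (y' - y) < \<eta>" using mid y(2) y'(2) m[of "max m n"] \<eta>(1) by linarith
  moreover have "norm (y' - y) \<le> 2" using tail(2)[OF y(1)] tail(2)[OF y'(1)] norm_triangle_ineq4[of y' y] by simp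
  ultimately have "F n (y' - y) < c / 2" using c0_diff[OF tail(1)[OF y'(1)] tail(1)[OF y(1)]] by (intro \<eta>(2))
  moreover have "c \<le> F n y'" using tail(3)[OF y'(1)] by simp
  ultimately show False using n dual_diff[OF F tail(1)[OF y'(1)] tail(1)[OF y(1)]] by simp
qed

text \<open>
  If \<open>\<phi> (F n)\<close> does not tend to \<open>0\<close>, then for one sign \<open>s\<close> the values \<open>s * \<phi> (F n)\<close> stay above some
  \<open>\<delta>\<close> along a subsequence, and this subsequence, multiplied by \<open>s\<close>, contradicts the previous lemma.
\<close>

lemma weak_star_null_imp_weakly_null:
  assumes F: "\<And>n. F n \<in> dual" and null: "weak_star_null (c0 I) F"
    and exh: "\<And>F. (\<And>n. F n \<in> dual) \<Longrightarrow> weak_star_null (c0 I) F \<Longrightarrow>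
      uniformly_exhaustive I (\<lambda>n A. tv (F n) (indicator A))"
  shows "weakly_null_in_dual (c0 I) F"
  unfolding weakly_null_in_dual_def
proof
  fix \<phi> assume \<phi>: "\<phi> \<in> bidual_space (c0 I)"
  have one_sided: "finite {n. \<delta> \<le> s * \<phi> (F n)}" if "0 < \<delta>" for \<delta> s
  proof (rule ccontr)
    assume "infinite {n. \<delta> \<le> s * \<phi> (F n)}"
    from infinite_enumerate[OF this] obtain r :: "nat \<Rightarrow> nat"
      where r: "strict_mono r" "\<And>k. \<delta> \<le> s * \<phi> (F (r k))" by auto
    define G where "G k = (\<lambda>x. s * F (r k) x)" for k
    have G: "G k \<in> dual" for k unfolding G_def by (rule dual_space_scale[OF F])
    have "weak_star_null (c0 I) (\<lambda>k. F (r k))"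
      by (rule weak_star_null_subsequence[OF null filterlim_subseq[OF r(1)]])
    then have G_null: "weak_star_null (c0 I) G"
      unfolding weak_star_null_def G_def by (auto intro: tendsto_mult_right_zero)
    have "\<phi> (G k) = s * \<phi> (F (r k))" for k
      unfolding G_def by (rule bidual_scale[OF \<phi> F])
    then show False
      using no_uniform_bidual_bound[OF G G_null exh[OF G G_null] \<phi> \<open>0 < \<delta>\<close>] r(2) by (auto simp: not_less[symmetric])
  qed
  show "(\<lambda>n. \<phi> (F n)) \<longlonglongrightarrow> 0"
  proof (rule tendstoI)
    fix \<delta> :: real assume "0 < \<delta>"
    have "finite ({n. \<delta> \<le> 1 * \<phi> (F n)} \<union> {n. \<delta> \<le> (-1) * \<phi> (F n)})"
      using one_sided[OF \<open>0 < \<delta>\<close>] by blast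
    then have "finite {n. \<not> dist (\<phi> (F n)) 0 < \<delta>}" by (rule finite_subset[rotated]) auto
    then show "eventually (\<lambda>n. dist (\<phi> (F n)) 0 < \<delta>) sequentially"
      by (simp add: cofinite_eq_sequentially[symmetric] eventually_cofinite)
  qed
qed

end

theorem theorem2p5:
  shows "grothendieck_ideal nwd"
proof -
  have "weakly_null_in_dual (c0 nwd) F"
    if "\<And>n. F n \<in> dual_space (c0 nwd)" "weak_star_null (c0 nwd) F" for F
    by (rule nwd.weak_star_null_imp_weakly_null[OF that nwd_uniformly_exhaustive])
  then show ?thesis
    unfolding grothendieck_ideal_def grothendieck_space_def
    using set_ideal_nwd nwd.banach_subspace_c0 by blast
qed

end
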